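(* Let $\mathbb K$ be a field of characteristic zero, let $q\ge2$ and let $V(\lambda)$ be an infinite-dimensional irreducible $\mathfrak{sl}(2,\mathbb K)$-module (the module with highest weight $\lambda\in\mathbb K$, $\lambda\notin\{0,1,2,\dots\}$, defined in the context). Then its $q$-th exterior power $\Lambda^q(V(\lambda))$ is reducible. The subspace of its primitive vectors of weight $\lambda q-2k$ has dimension $$P_q\Big(k-\tfrac{(q-3)q}{2}\Big)-P_q\Big(k-\tfrac{(q-3)q}{2}-1\Big),$$ and one can take the following basis of it: $$\omega(\tilde f_{i_1}\wedge\dots\wedge\tilde f_{i_{q-2}}\wedge\tilde f_i\wedge\tilde f_{i+1})=\sum_{l\ge0}(-1)^lX^l(\tilde f_{i_1}\wedge\dots\wedge\tilde f_{i_{q-2}}\wedge\tilde f_i)\wedge\tilde f_{i+1+l},$$ $$0\le i_1<i_2<\dots<i_{q-2}<i,\qquad \sum_{l=1}^{q-2}i_l+2i+1=k.$$ That means the module $\Lambda^q(V(\lambda))$ is decomposed into the direct sum of its highest weight submodules $\Lambda^q(V(\lambda))=\bigoplus V_{i_1\dots i_{q-2},i}$, where the highest weight vector of $V_{i_1\dots i_{q-2},i}$ is $\omega(\tilde f_{i_1}\wedge\dots\wedge\tilde f_{i_{q-2}}\wedge\tilde f_i\wedge\tilde f_{i+1})$.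
   Context: $X,Y,H$ is the standard basis of $\mathfrak{sl}(2,\mathbb K)$: $[X,Y]=H$, $[H,X]=2X$, $[H,Y]=-2Y$. For $\lambda\in\mathbb K$, $V(\lambda)$ has basis $\{f_i:i\ge0\}$ with $Hf_i=(\lambda-2i)f_i$, $Yf_i=(i+1)f_{i+1}$, $Xf_i=(\lambda-i+1)f_{i-1}$, where $f_{-1}=0$ (the Verma module); it is irreducible if and only if $\lambda\notin\{0,1,2,\dots\}$. In that case set $\tilde f_0=f_0$ and $\tilde f_i=f_i/\prod_{l=1}^i(\lambda-l+1)$ for $i\ge1$, so that $X\tilde f_i=\tilde f_{i-1}$ (with $\tilde f_{-1}=0$). $\mathfrak{sl}(2,\mathbb K)$ acts on exterior powers by derivations. A primitive vector (highest weight vector) of weight $\mu$ is a vector $v$ with $Xv=0$, $Hv=\mu v$ (zero being included when speaking of the subspace of primitive vectors). $P_q(N)$ is the number of partitions of $N$ into $q$ parts, i.e. the number of solutions of $N=x_1+\dots+x_q$ in integers $1\le x_1\le\dots\le x_q$.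
   Formalization: The direct sum decomposition is claimed only when the highest weight qλ − q(q−1) of the exterior power is not a non-negative integer; otherwise (e.g. q=2, λ=3/2) the sum is not direct and the claim fails. *)

theory Defs
  imports Complex_Main "HOL-Library.Poly_Mapping"
begin

section \<open>Representations of \<open>sl(2,K)\<close>\<close>

text \<open>
  A representation of \<open>sl(2,K)\<close> on a vector space is given by three linear endomorphisms satisfying
  the bracket relations of the standard basis \<open>X, Y, H\<close>.  Since these span \<open>sl(2,K)\<close>, a submodule is
  a subspace stable under the three of them.
\<close>

locale sl2_module = vector_space scale
  for scale :: "'k::field \<Rightarrow> 'v::ab_group_add \<Rightarrow> 'v" +
  fixes X Y H :: "'v \<Rightarrow> 'v"
  assumes linear_X: "Vector_Spaces.linear scale scale X"
    and linear_Y: "Vector_Spaces.linear scale scale Y"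
    and linear_H: "Vector_Spaces.linear scale scale H"
    and bracket_XY: "X (Y v) - Y (X v) = H v"
    and bracket_HX: "H (X v) - X (H v) = scale 2 (X v)"
    and bracket_HY: "H (Y v) - Y (H v) = - scale 2 (Y v)"
begin

definition submodule :: "'v set \<Rightarrow> bool" where
  "submodule N \<longleftrightarrow> subspace N \<and> X ` N \<subseteq> N \<and> Y ` N \<subseteq> N \<and> H ` N \<subseteq> N"

definition generated :: "'v \<Rightarrow> 'v set" where
  "generated v = submodule hull {v}"

definition reducible :: "'v set \<Rightarrow> bool" where
  "reducible M \<longleftrightarrow> submodule M \<and> (\<exists>N. submodule N \<and> N \<subseteq> M \<and> N \<noteq> {0} \<and> N \<noteq> M)"

definition irreducible :: "'v set \<Rightarrow> bool" where
  "irreducible M \<longleftrightarrow> submodule M \<and> M \<noteq> {0} \<and> (\<forall>N. submodule N \<and> N \<subseteq> M \<longrightarrow> N = {0} \<or> N = M)"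

definition primitive_vectors :: "'v set \<Rightarrow> 'k \<Rightarrow> 'v set" where
  "primitive_vectors M \<mu> = {v \<in> M. X v = 0 \<and> H v = scale \<mu> v}"

definition highest_weight_vector :: "'v \<Rightarrow> 'k \<Rightarrow> bool" where
  "highest_weight_vector v \<mu> \<longleftrightarrow> v \<noteq> 0 \<and> X v = 0 \<and> H v = scale \<mu> v"

definition direct_sum_of_submodules :: "'v set \<Rightarrow> 'i set \<Rightarrow> ('i \<Rightarrow> 'v set) \<Rightarrow> bool" where
  "direct_sum_of_submodules M I N \<longleftrightarrow>
     (\<forall>i\<in>I. submodule (N i)) \<and>
     M = span (\<Union>i\<in>I. N i) \<and>
     (\<forall>J f. finite J \<and> J \<subseteq> I \<and> (\<forall>j\<in>J. f j \<in> N j) \<and> (\<Sum>j\<in>J. f j) = 0 \<longrightarrow> (\<forall>j\<in>J. f j = 0))"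

end


section \<open>Vector spaces with a given basis\<close>

text \<open>The vector space with basis \<open>'a\<close> over \<open>'k\<close> is the type of finitely supported functions.\<close>

definition pm_scale :: "'k \<Rightarrow> ('a \<Rightarrow>\<^sub>0 'k) \<Rightarrow> ('a \<Rightarrow>\<^sub>0 'k::field)" where
  "pm_scale c p = Poly_Mapping.map ((*) c) p"

lemma lookup_pm_scale [simp]: "Poly_Mapping.lookup (pm_scale c p) a = c * Poly_Mapping.lookup p a"
  by (simp add: pm_scale_def Poly_Mapping.map.rep_eq when_def)

interpretation pm: vector_space "pm_scale :: 'k::field \<Rightarrow> ('a \<Rightarrow>\<^sub>0 'k) \<Rightarrow> _"
  by unfold_locales (rule poly_mapping_eqI; simp add: lookup_add algebra_simps)+

lemma pm_scale_single [simp]: "pm_scale c (Poly_Mapping.single a d) = Poly_Mapping.single a (c * d)"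
  by (rule poly_mapping_eqI) (simp add: lookup_single when_def)

definition lin_ext :: "('a \<Rightarrow> ('b \<Rightarrow>\<^sub>0 'k::field)) \<Rightarrow> ('a \<Rightarrow>\<^sub>0 'k) \<Rightarrow> ('b \<Rightarrow>\<^sub>0 'k)" where
  "lin_ext g p = (\<Sum>a\<in>Poly_Mapping.keys p. pm_scale (Poly_Mapping.lookup p a) (g a))"

lemma lin_ext_superset:
  assumes "finite A" "Poly_Mapping.keys p \<subseteq> A"
  shows "lin_ext g p = (\<Sum>a\<in>A. pm_scale (Poly_Mapping.lookup p a) (g a))"
  unfolding lin_ext_def
  by (rule sum.mono_neutral_left) (use assms in \<open>auto simp: in_keys_iff\<close>)

lemma lin_ext_add: "lin_ext g (p + q) = lin_ext g p + lin_ext g q"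
proof -
  let ?A = "Poly_Mapping.keys p \<union> Poly_Mapping.keys q"
  have "Poly_Mapping.keys (p + q) \<subseteq> ?A" by (rule keys_add)
  then show ?thesis
    by (simp add: lin_ext_superset[of ?A] lookup_add pm.scale_left_distrib sum.distrib)
qed

lemma lin_ext_scale: "lin_ext g (pm_scale c p) = pm_scale c (lin_ext g p)"
proof -
  have "Poly_Mapping.keys (pm_scale c p) \<subseteq> Poly_Mapping.keys p" by (auto simp: in_keys_iff)
  then show ?thesis
    by (simp add: lin_ext_superset[of "Poly_Mapping.keys p"] pm.scale_sum_right)
qed

lemma lin_ext_zero [simp]: "lin_ext g 0 = 0"
  by (simp add: lin_ext_def)

lemma lin_ext_single [simp]: "lin_ext g (Poly_Mapping.single a c) = pm_scale c (g a)"
  by (simp add: lin_ext_superset[of "{a}"])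

lemma linear_lin_ext: "Vector_Spaces.linear pm_scale pm_scale (lin_ext g)"
  by unfold_locales (rule lin_ext_add lin_ext_scale)+

lemma pm_induct [case_names zero single add]:
  fixes p :: "'a \<Rightarrow>\<^sub>0 'k::field"
  assumes "P 0" "\<And>a. P (Poly_Mapping.single a 1)"
    and "\<And>p q c. P p \<Longrightarrow> P q \<Longrightarrow> P (pm_scale c p + q)"
  shows "P p"
proof -
  have s: "P (Poly_Mapping.single a c)" for a c
    using assms(3)[OF assms(2)[of a] assms(1), of c] by simp
  have a: "P (p + q)" if "P p" "P q" for p q
    using assms(3)[OF that, of 1] by simp
  have "P (\<Sum>b\<in>A. Poly_Mapping.single b (Poly_Mapping.lookup p b))" if "finite A" for A
    using that by (induction A) (auto intro: s a assms(1))
  moreover have "(\<Sum>b\<in>Poly_Mapping.keys p. Poly_Mapping.single b (Poly_Mapping.lookup p b)) = p"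
    by (rule poly_mapping_eqI) (simp add: lookup_sum lookup_single when_def in_keys_iff)
  ultimately show ?thesis
    by (metis finite_keys)
qed

lemma linear_eq_lin_ext:
  assumes "Vector_Spaces.linear pm_scale pm_scale D"
  shows "D p = lin_ext (\<lambda>a. D (Poly_Mapping.single a 1)) p"
proof -
  interpret D: Vector_Spaces.linear pm_scale pm_scale D by fact
  show ?thesis
    by (induction p rule: pm_induct) (simp_all add: D.zero D.add D.scale lin_ext_add lin_ext_scale)
qed


section \<open>The tensor algebra and the exterior algebra\<close>

text \<open>
  Words over the basis \<open>'a\<close> form the free monoid (with \<open>0 = []\<close> and \<open>+\<close> being concatenation), so the
  convolution product makes the finitely supported functions on words the tensor algebra of the
  space \<open>'a \<Rightarrow>\<^sub>0 'k\<close>.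
\<close>

instantiation list :: (type) monoid_add
begin
definition zero_list :: "'a list" where "zero_list = []"
definition plus_list :: "'a list \<Rightarrow> 'a list \<Rightarrow> 'a list" where "plus_list = (@)"
instance by standard (simp_all add: zero_list_def plus_list_def)
end

type_synonym ('a, 'k) tensor_algebra = "'a list \<Rightarrow>\<^sub>0 'k"

definition tens_vec :: "('a \<Rightarrow>\<^sub>0 'k::field) \<Rightarrow> ('a, 'k) tensor_algebra" where
  "tens_vec = lin_ext (\<lambda>a. Poly_Mapping.single [a] 1)"

definition ext_ideal :: "('a, 'k::field) tensor_algebra set" where
  "ext_ideal = pm.span {s * (tens_vec v * tens_vec v) * t | s v t. True}"

text \<open>The extension of an endomorphism \<open>D\<close> of the space to a derivation of the tensor algebra.\<close>

definition tens_deriv ::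
  "(('a \<Rightarrow>\<^sub>0 'k) \<Rightarrow> ('a \<Rightarrow>\<^sub>0 'k::field)) \<Rightarrow> ('a, 'k) tensor_algebra \<Rightarrow> ('a, 'k) tensor_algebra" where
  "tens_deriv D = lin_ext (\<lambda>w. \<Sum>j<length w.
     Poly_Mapping.single (take j w) 1 *
     tens_vec (D (Poly_Mapping.single (w ! j) 1)) *
     Poly_Mapping.single (drop (Suc j) w) 1)"

lemma pm_scale_mult_left: "pm_scale c s * t = pm_scale c (s * t)"
  for s t :: "('a, 'k::field) tensor_algebra"
  by (simp add: pm_scale_def mult_map_scale_conv_mult mult.assoc)

lemma pm_scale_mult_right: "s * pm_scale c t = pm_scale c (s * t)"
  for s t :: "('a, 'k::field) tensor_algebra"
proof (induction s rule: pm_induct)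
  case (single a)
  show ?case
  proof (induction t arbitrary: c rule: pm_induct)
    case (single b)
    then show ?case by (simp add: mult_single)
  next
    case (add p q d)
    then show ?case
      by (simp add: pm.scale_right_distrib distrib_left)
  qed simp
next
  case (add p q d)
  then show ?case
    by (simp add: distrib_right pm_scale_mult_left pm.scale_right_distrib mult.commute)
qed simp

lemma ext_ideal_mult: assumes "x \<in> ext_ideal" shows "s * x * t \<in> ext_ideal"
  using assms unfolding ext_ideal_def
proof (induction x rule: pm.span_induct_alt)
  case base
  then show ?case by (simp add: pm.span_zero)
next
  case (step c x y)
  then obtain a v b where "x = a * (tens_vec v * tens_vec v) * b" by blast
  then have "s * x * t = (s * a) * (tens_vec v * tens_vec v) * (b * t)" by (simp add: mult.assoc)
  then have "s * x * t \<in> pm.span {s * (tens_vec v * tens_vec v) * t | s v t. True}"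
    by (intro pm.span_base) blast
  then show ?case
    using step(2)
    by (simp add: distrib_left distrib_right pm_scale_mult_left pm_scale_mult_right pm.span_add pm.span_scale)
qed

lemma ext_ideal_mult_left: "x \<in> ext_ideal \<Longrightarrow> s * x \<in> ext_ideal"
  using ext_ideal_mult[of x s 1] by simp

lemma ext_ideal_mult_right: "x \<in> ext_ideal \<Longrightarrow> x * t \<in> ext_ideal"
  using ext_ideal_mult[of x 1 t] by simp

lemma subspace_ext_ideal: "pm.subspace ext_ideal"
  by (simp add: ext_ideal_def)

lemmas ext_ideal_intros =
  pm.subspace_0[OF subspace_ext_ideal] pm.subspace_add[OF subspace_ext_ideal]
  pm.subspace_diff[OF subspace_ext_ideal] pm.subspace_neg[OF subspace_ext_ideal]
  pm.subspace_scale[OF subspace_ext_ideal] ext_ideal_mult_left ext_ideal_mult_right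

lemma tens_vec_sum: "tens_vec (v + w) = tens_vec v + tens_vec w"
  "tens_vec (pm_scale c v) = pm_scale c (tens_vec v)" "tens_vec 0 = 0"
  "tens_vec (Poly_Mapping.single a c) = Poly_Mapping.single [a] c"
  by (simp_all add: tens_vec_def lin_ext_add lin_ext_scale)

lemma tens_deriv_linear: "tens_deriv D (s + t) = tens_deriv D s + tens_deriv D t"
  "tens_deriv D (pm_scale c s) = pm_scale c (tens_deriv D s)" "tens_deriv D 0 = 0"
  by (simp_all add: tens_deriv_def lin_ext_add lin_ext_scale)

lemma single_append: "Poly_Mapping.single (u @ w) (1::'k::field) = Poly_Mapping.single u 1 * Poly_Mapping.single w 1"
  by (simp add: mult_single plus_list_def)

lemma single_Nil: "Poly_Mapping.single [] 1 = (1 :: ('a, 'k::field) tensor_algebra)"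
  by (metis zero_list_def single_one)

lemma tens_deriv_Nil: "tens_deriv D (Poly_Mapping.single [] 1) = 0"
  by (simp add: tens_deriv_def)

lemma tens_deriv_one: "tens_deriv D 1 = 0"
  using tens_deriv_Nil by (simp add: single_Nil)

lemma tens_deriv_Cons:
  fixes D :: "('a \<Rightarrow>\<^sub>0 'k) \<Rightarrow> ('a \<Rightarrow>\<^sub>0 'k::field)"
  shows "tens_deriv D (Poly_Mapping.single (a # w) 1) =
     tens_vec (D (Poly_Mapping.single a 1)) * Poly_Mapping.single w 1 +
     Poly_Mapping.single [a] 1 * tens_deriv D (Poly_Mapping.single w 1)"
proof -
  have *: "Poly_Mapping.single (a # u) 1 = Poly_Mapping.single [a] 1 * (Poly_Mapping.single u 1 :: ('a, 'k) tensor_algebra)" for u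
    using single_append[of "[a]" u] by simp
  show ?thesis
    by (simp add: tens_deriv_def sum.lessThan_Suc_shift single_Nil sum_distrib_left
        *[of "take j w" for j] mult.assoc del: sum.lessThan_Suc)
qed

lemma tens_deriv_append:
  fixes D :: "('a \<Rightarrow>\<^sub>0 'k) \<Rightarrow> ('a \<Rightarrow>\<^sub>0 'k::field)"
  shows "tens_deriv D (Poly_Mapping.single (u @ w) 1) =
     tens_deriv D (Poly_Mapping.single u 1) * Poly_Mapping.single w 1 +
     Poly_Mapping.single u 1 * tens_deriv D (Poly_Mapping.single w 1)"
proof (induction u)
  case Nil
  then show ?case by (simp add: single_Nil tens_deriv_one)
next
  case (Cons a u)
  let ?V = "tens_vec (D (Poly_Mapping.single a 1))"
  let ?A = "Poly_Mapping.single [a] (1::'k)"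
  let ?U = "Poly_Mapping.single u (1::'k)"
  let ?W = "Poly_Mapping.single w (1::'k)"
  have A: "Poly_Mapping.single (a # u) 1 = ?A * ?U"
    using single_append[of "[a]" u] by simp
  have "tens_deriv D (Poly_Mapping.single ((a # u) @ w) 1) =
      ?V * Poly_Mapping.single (u @ w) 1 + ?A * tens_deriv D (Poly_Mapping.single (u @ w) 1)"
    by (simp add: tens_deriv_Cons)
  also have "\<dots> = ?V * (?U * ?W) + ?A * (tens_deriv D ?U * ?W + ?U * tens_deriv D ?W)"
    by (subst Cons) (simp only: single_append)
  also have "\<dots> = (?V * ?U + ?A * tens_deriv D ?U) * ?W + (?A * ?U) * tens_deriv D ?W"
    by (simp add: distrib_left distrib_right mult.assoc add.assoc)
  also have "\<dots> = tens_deriv D (Poly_Mapping.single (a # u) 1) * ?W + Poly_Mapping.single (a # u) 1 * tens_deriv D ?W"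
    unfolding tens_deriv_Cons by (simp only: A)
  finally show ?case .
qed

lemma tens_deriv_mult: "tens_deriv D (s * t) = tens_deriv D s * t + s * tens_deriv D t"
proof (induction s rule: pm_induct)
  case (single u)
  show ?case
  proof (induction t rule: pm_induct)
    case (single w)
    then show ?case by (simp add: tens_deriv_append flip: single_append)
  next
    case (add p q c)
    then show ?case
      by (simp add: tens_deriv_linear pm_scale_mult_right distrib_left pm.scale_right_distrib add_ac)
  qed (simp add: tens_deriv_linear)
next
  case (add p q c)
  then show ?case
    by (simp add: tens_deriv_linear pm_scale_mult_left distrib_right pm.scale_right_distrib add_ac)
qed (simp add: tens_deriv_linear)

lemma tens_deriv_vec:
  "tens_deriv D (tens_vec v) = tens_vec (lin_ext (\<lambda>a. D (Poly_Mapping.single a 1)) v)"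
  by (induction v rule: pm_induct)
    (simp_all add: tens_deriv_linear tens_vec_sum lin_ext_add lin_ext_scale tens_deriv_Cons
      tens_deriv_one single_Nil)

lemma tens_deriv_ideal:
  fixes x :: "('a, 'k::field) tensor_algebra"
  assumes "x \<in> ext_ideal" shows "tens_deriv D x \<in> ext_ideal"
  using assms unfolding ext_ideal_def
proof (induction x rule: pm.span_induct_alt)
  case base
  then show ?case by (simp add: tens_deriv_linear pm.span_zero)
next
  case (step c x y)
  then obtain a v b where x: "x = a * (tens_vec v * tens_vec v) * b" by blast
  have sq: "tens_vec v * tens_vec v \<in> ext_ideal" for v :: "'a \<Rightarrow>\<^sub>0 'k"
    unfolding ext_ideal_def by (intro pm.span_base CollectI exI[of _ 1] exI[of _ v]) simp
  define w where "w = lin_ext (\<lambda>a. D (Poly_Mapping.single a 1)) v"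
  have "tens_vec w * tens_vec v + tens_vec v * tens_vec w =
      tens_vec (v + w) * tens_vec (v + w) - tens_vec v * tens_vec v - tens_vec w * tens_vec w"
    by (simp add: tens_vec_sum algebra_simps)
  also have "\<dots> \<in> ext_ideal" by (intro ext_ideal_intros(2,3) sq)
  finally have wv: "tens_vec w * tens_vec v + tens_vec v * tens_vec w \<in> ext_ideal" .
  have "tens_deriv D a * (tens_vec v * tens_vec v) * b +
      a * (tens_vec w * tens_vec v + tens_vec v * tens_vec w) * b +
      a * (tens_vec v * tens_vec v) * tens_deriv D b \<in> ext_ideal"
    by (intro ext_ideal_intros(2) ext_ideal_mult[OF sq] ext_ideal_mult[OF wv])
  also have "tens_deriv D a * (tens_vec v * tens_vec v) * b +
      a * (tens_vec w * tens_vec v + tens_vec v * tens_vec w) * b +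
      a * (tens_vec v * tens_vec v) * tens_deriv D b = tens_deriv D x"
    unfolding x tens_deriv_mult tens_deriv_vec w_def[symmetric]
    by (simp add: distrib_right)
  finally have "tens_deriv D x \<in> ext_ideal" .
  then show ?case
    using step(2) by (simp add: tens_deriv_linear pm.span_add pm.span_scale ext_ideal_def)
qed

lemma lookup_mult_Nil:
  "Poly_Mapping.lookup (s * t) [] = Poly_Mapping.lookup s [] * Poly_Mapping.lookup t []"
  for s t :: "('a, 'k::field) tensor_algebra"
proof (induction s rule: pm_induct)
  case (single u)
  show ?case
    by (induction t rule: pm_induct)
      (auto simp: mult_single plus_list_def lookup_single when_def lookup_add algebra_simps
        pm_scale_mult_right)
qed (simp_all add: lookup_add algebra_simps pm_scale_mult_left)

lemma one_notin_ext_ideal: "1 \<notin> (ext_ideal :: ('a, 'k::field) tensor_algebra set)"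
proof
  have v: "Poly_Mapping.lookup (tens_vec v) [] = (0::'k)" for v :: "'a \<Rightarrow>\<^sub>0 'k"
    by (induction v rule: pm_induct) (simp_all add: tens_vec_sum lookup_add lookup_single)
  have "Poly_Mapping.lookup x [] = 0" if "x \<in> ext_ideal" for x :: "('a, 'k) tensor_algebra"
    using that unfolding ext_ideal_def
    by (induction x rule: pm.span_induct_alt) (auto simp: lookup_add lookup_mult_Nil v)
  moreover assume "1 \<in> (ext_ideal :: ('a, 'k) tensor_algebra set)"
  ultimately have "Poly_Mapping.lookup (1 :: ('a, 'k) tensor_algebra) [] = 0" by blast
  then show False by (metis lookup_single_eq single_Nil zero_neq_one)
qed

text \<open>The exterior algebra: the tensor algebra modulo the ideal generated by the squares of vectors.\<close>

definition ext_rel :: "('a, 'k::field) tensor_algebra \<Rightarrow> ('a, 'k) tensor_algebra \<Rightarrow> bool" where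
  "ext_rel s t \<longleftrightarrow> s - t \<in> ext_ideal"

lemma equivp_ext_rel: "equivp (ext_rel :: ('a, 'b::field) tensor_algebra \<Rightarrow> _)"
proof (rule equivpI)
  show "reflp (ext_rel :: ('a, 'b) tensor_algebra \<Rightarrow> _)" by (simp add: reflp_def ext_rel_def ext_ideal_intros(1))
  show "symp (ext_rel :: ('a, 'b) tensor_algebra \<Rightarrow> _)"
  proof (rule sympI)
    fix s t :: "('a, 'b) tensor_algebra"
    assume "ext_rel s t"
    then show "ext_rel t s" using ext_ideal_intros(4)[of "s - t"] by (simp add: ext_rel_def)
  qed
  show "transp (ext_rel :: ('a, 'b) tensor_algebra \<Rightarrow> _)"
  proof (rule transpI)
    fix s t u :: "('a, 'b) tensor_algebra"
    assume "ext_rel s t" "ext_rel t u"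
    then show "ext_rel s u" using ext_ideal_intros(2)[of "s - t" "t - u"] by (simp add: ext_rel_def)
  qed
qed

quotient_type (overloaded) ('a, 'k) exterior_algebra = "('a, 'k::field) tensor_algebra" / ext_rel
  by (rule equivp_ext_rel)

instantiation exterior_algebra :: (type, field) ring_1
begin

lift_definition zero_exterior_algebra :: "('a, 'b) exterior_algebra" is 0 .
lift_definition one_exterior_algebra :: "('a, 'b) exterior_algebra" is 1 .
lift_definition plus_exterior_algebra ::
  "('a, 'b) exterior_algebra \<Rightarrow> ('a, 'b) exterior_algebra \<Rightarrow> ('a, 'b) exterior_algebra" is "(+)"
proof -
  fix s s' t t' :: "('a, 'b) tensor_algebra"
  assume "ext_rel s s'" "ext_rel t t'"
  then have "(s - s') + (t - t') \<in> ext_ideal"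
    unfolding ext_rel_def by (rule ext_ideal_intros)
  then show "ext_rel (s + t) (s' + t')"
    by (simp add: ext_rel_def algebra_simps)
qed
lift_definition minus_exterior_algebra ::
  "('a, 'b) exterior_algebra \<Rightarrow> ('a, 'b) exterior_algebra \<Rightarrow> ('a, 'b) exterior_algebra" is "(-)"
proof -
  fix s s' t t' :: "('a, 'b) tensor_algebra"
  assume "ext_rel s s'" "ext_rel t t'"
  then have "(s - s') - (t - t') \<in> ext_ideal"
    unfolding ext_rel_def by (rule ext_ideal_intros)
  then show "ext_rel (s - t) (s' - t')"
    by (simp add: ext_rel_def algebra_simps)
qed
lift_definition uminus_exterior_algebra ::
  "('a, 'b) exterior_algebra \<Rightarrow> ('a, 'b) exterior_algebra" is uminus
proof -
  fix s s' :: "('a, 'b) tensor_algebra"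
  assume "ext_rel s s'"
  then have "- (s - s') \<in> ext_ideal"
    unfolding ext_rel_def by (rule ext_ideal_intros)
  then show "ext_rel (- s) (- s')"
    by (simp add: ext_rel_def)
qed
lift_definition times_exterior_algebra ::
  "('a, 'b) exterior_algebra \<Rightarrow> ('a, 'b) exterior_algebra \<Rightarrow> ('a, 'b) exterior_algebra" is "(*)"
proof -
  fix s s' t t' :: "('a, 'b) tensor_algebra"
  assume "ext_rel s s'" "ext_rel t t'"
  then have "(s - s') * t + s' * (t - t') \<in> ext_ideal"
    unfolding ext_rel_def
    by (intro ext_ideal_intros(2) ext_ideal_mult_left ext_ideal_mult_right)
  then show "ext_rel (s * t) (s' * t')"
    by (simp add: ext_rel_def algebra_simps)
qed

instance
proof
  have r: "ext_rel s s" for s :: "('a, 'b) tensor_algebra"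
    by (simp add: ext_rel_def ext_ideal_intros(1))
  fix a b c :: "('a, 'b) exterior_algebra"
  show "a + b + c = a + (b + c)" by transfer (simp add: add.assoc r)
  show "a + b = b + a" by transfer (simp add: add.commute r)
  show "0 + a = a" by transfer (simp add: r)
  show "- a + a = 0" by transfer (simp add: r)
  show "a - b = a + - b" by transfer (simp add: r)
  show "a * b * c = a * (b * c)" by transfer (simp add: mult.assoc r)
  show "1 * a = a" by transfer (simp add: r)
  show "a * 1 = a" by transfer (simp add: r)
  show "(a + b) * c = a * c + b * c" by transfer (simp add: distrib_right r)
  show "a * (b + c) = a * b + a * c" by transfer (simp add: distrib_left r)
  show "(0 :: ('a, 'b) exterior_algebra) \<noteq> 1"
  proof
    assume "(0 :: ('a, 'b) exterior_algebra) = 1"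
    then have "ext_rel (0 :: ('a, 'b) tensor_algebra) 1" by transfer
    then have "- (0 - 1) \<in> (ext_ideal :: ('a, 'b) tensor_algebra set)"
      unfolding ext_rel_def by (rule ext_ideal_intros)
    then show False by (simp add: one_notin_ext_ideal)
  qed
qed

end

lift_definition ext_scale :: "'k \<Rightarrow> ('a, 'k) exterior_algebra \<Rightarrow> ('a, 'k::field) exterior_algebra"
  is pm_scale
  by (simp add: ext_rel_def ext_ideal_intros(5) flip: pm.scale_right_diff_distrib)

lift_definition ext_vec :: "('a \<Rightarrow>\<^sub>0 'k) \<Rightarrow> ('a, 'k::field) exterior_algebra" is tens_vec .

lift_definition ext_deriv ::
  "(('a \<Rightarrow>\<^sub>0 'k) \<Rightarrow> ('a \<Rightarrow>\<^sub>0 'k)) \<Rightarrow> ('a, 'k) exterior_algebra \<Rightarrow> ('a, 'k::field) exterior_algebra"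
  is tens_deriv
proof -
  fix D :: "('a \<Rightarrow>\<^sub>0 'k) \<Rightarrow> ('a \<Rightarrow>\<^sub>0 'k)" and s t :: "('a, 'k) tensor_algebra"
  assume "ext_rel s t"
  then have "tens_deriv D (s - t) \<in> ext_ideal"
    unfolding ext_rel_def by (rule tens_deriv_ideal)
  moreover have "tens_deriv D s = tens_deriv D (s - t) + tens_deriv D t"
    by (metis tens_deriv_linear(1) diff_add_cancel)
  ultimately show "ext_rel (tens_deriv D s) (tens_deriv D t)"
    by (simp add: ext_rel_def)
qed

lemma ext_rel_refl: "ext_rel s s"
  by (simp add: ext_rel_def ext_ideal_intros(1))

interpretation ext: vector_space "ext_scale :: 'k::field \<Rightarrow> ('a, 'k) exterior_algebra \<Rightarrow> _"
  by unfold_locales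
    (transfer; simp add: pm.scale_right_distrib pm.scale_left_distrib ext_rel_refl)+

text \<open>\<open>\<Lambda>\<^sup>q\<close>; the wedge product is the ring multiplication of the exterior algebra.\<close>

definition wedge :: "('a \<Rightarrow>\<^sub>0 'k) list \<Rightarrow> ('a, 'k::field) exterior_algebra" where
  "wedge vs = prod_list (map ext_vec vs)"

definition ext_power :: "nat \<Rightarrow> ('a, 'k::field) exterior_algebra set" where
  "ext_power q = ext.span {wedge vs | vs. length vs = q}"

lemma ext_vec_square: "ext_vec v * ext_vec v = 0"
  by transfer
    (auto simp: ext_rel_def ext_ideal_def intro!: pm.span_base exI[of _ 1])

lemma ext_deriv_mult: "ext_deriv D (s * t) = ext_deriv D s * t + s * ext_deriv D t"
  by transfer (simp add: tens_deriv_mult ext_rel_refl)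

lemma ext_deriv_vec:
  assumes "Vector_Spaces.linear pm_scale pm_scale D"
  shows "ext_deriv D (ext_vec v) = ext_vec (D v)"
proof -
  have "ext_deriv D (ext_vec v) = ext_vec (lin_ext (\<lambda>a. D (Poly_Mapping.single a 1)) v)"
    by transfer (simp add: tens_deriv_vec ext_rel_refl)
  then show ?thesis by (simp flip: linear_eq_lin_ext[OF assms])
qed

lemma linear_ext_deriv: "Vector_Spaces.linear ext_scale ext_scale (ext_deriv D)"
  by unfold_locales (transfer; simp add: tens_deriv_linear ext_rel_refl)+

lemma tens_deriv_commutator:
  fixes s :: "('a, 'k::field) tensor_algebra"
  assumes "Vector_Spaces.linear pm_scale pm_scale D" "Vector_Spaces.linear pm_scale pm_scale E"
    and "Vector_Spaces.linear pm_scale pm_scale F"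
    and "\<And>v. D (E v) - E (D v) = pm_scale c (F v)"
  shows "tens_deriv D (tens_deriv E s) - tens_deriv E (tens_deriv D s) = pm_scale c (tens_deriv F s)"
proof (induction s rule: pm_induct)
  case (single w)
  show ?case
  proof (induction w)
    case (Cons a w)
    have "D (E v) = E (D v) + pm_scale c (F v)" for v
      using assms(4)[of v] by (simp add: diff_eq_eq add.commute)
    then have DE: "tens_vec (D (E v)) = tens_vec (E (D v)) + pm_scale c (tens_vec (F v))" for v
      by (simp add: tens_vec_sum)
    have IH: "tens_deriv D (tens_deriv E (Poly_Mapping.single w 1)) =
        tens_deriv E (tens_deriv D (Poly_Mapping.single w 1)) +
        pm_scale c (tens_deriv F (Poly_Mapping.single w 1))"
      using Cons by (simp add: diff_eq_eq add.commute)
    have vec: "tens_deriv G (tens_vec v) = tens_vec (G v)"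
      if "Vector_Spaces.linear pm_scale pm_scale G" for G and v :: "'a \<Rightarrow>\<^sub>0 'k"
      by (simp add: tens_deriv_vec flip: linear_eq_lin_ext[OF that])
    show ?case
      by (simp add: tens_deriv_Cons tens_deriv_linear tens_deriv_mult vec assms(1-3) DE IH
          tens_deriv_one single_Nil distrib_left distrib_right pm.scale_right_distrib
          pm_scale_mult_left pm_scale_mult_right diff_eq_eq add_ac)
  qed (simp add: tens_deriv_Nil tens_deriv_linear)
next
  case (add p q d)
  then have "tens_deriv D (tens_deriv E p) = tens_deriv E (tens_deriv D p) + pm_scale c (tens_deriv F p)"
    "tens_deriv D (tens_deriv E q) = tens_deriv E (tens_deriv D q) + pm_scale c (tens_deriv F q)"
    by (simp_all add: diff_eq_eq add.commute)
  then show ?case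
    by (simp add: tens_deriv_linear pm.scale_right_distrib mult.commute)
qed (simp add: tens_deriv_linear)

lemma ext_deriv_commutator:
  assumes "Vector_Spaces.linear pm_scale pm_scale D" "Vector_Spaces.linear pm_scale pm_scale E"
    and "Vector_Spaces.linear pm_scale pm_scale F"
    and "\<And>v. D (E v) - E (D v) = pm_scale c (F v)"
  shows "ext_deriv D (ext_deriv E s) - ext_deriv E (ext_deriv D s) = ext_scale c (ext_deriv F s)"
proof (induction s rule: exterior_algebra.abs_induct)
  case (1 t)
  show ?case
    by (simp add: ext_deriv.abs_eq ext_scale.abs_eq minus_exterior_algebra.abs_eq ext_rel_refl
        tens_deriv_commutator[OF assms])
qed


section \<open>The Verma module and its exterior powers\<close>

abbreviation verma_f :: "nat \<Rightarrow> (nat \<Rightarrow>\<^sub>0 'k::field)" where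
  "verma_f i \<equiv> Poly_Mapping.single i 1"

definition verma_H :: "'k \<Rightarrow> (nat \<Rightarrow>\<^sub>0 'k) \<Rightarrow> (nat \<Rightarrow>\<^sub>0 'k::field)" where
  "verma_H lam = lin_ext (\<lambda>i. pm_scale (lam - 2 * of_nat i) (verma_f i))"

definition verma_Y :: "(nat \<Rightarrow>\<^sub>0 'k) \<Rightarrow> (nat \<Rightarrow>\<^sub>0 'k::field)" where
  "verma_Y = lin_ext (\<lambda>i. pm_scale (of_nat i + 1) (verma_f (i + 1)))"

definition verma_X :: "'k \<Rightarrow> (nat \<Rightarrow>\<^sub>0 'k) \<Rightarrow> (nat \<Rightarrow>\<^sub>0 'k::field)" where
  "verma_X lam = lin_ext (\<lambda>i. if i = 0 then 0 else pm_scale (lam - of_nat i + 1) (verma_f (i - 1)))"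

lemma verma_linear_simps:
  "verma_H lam (pm_scale c p + q) = pm_scale c (verma_H lam p) + verma_H lam q" "verma_H lam 0 = 0"
  "verma_Y (pm_scale c p + q) = pm_scale c (verma_Y p) + verma_Y q" "verma_Y 0 = 0"
  "verma_X lam (pm_scale c p + q) = pm_scale c (verma_X lam p) + verma_X lam q" "verma_X lam 0 = 0"
  by (simp_all add: verma_H_def verma_Y_def verma_X_def lin_ext_add lin_ext_scale)

lemma lookup_verma_H: "Poly_Mapping.lookup (verma_H lam v) i = (lam - 2 * of_nat i) * Poly_Mapping.lookup v i"
proof (induction v rule: pm_induct)
  case (single a)
  then show ?case by (auto simp: verma_H_def lookup_single when_def simp del: single_one)
qed (simp_all add: verma_linear_simps lookup_add distrib_left mult.left_commute)

lemma lookup_verma_Y: "Poly_Mapping.lookup (verma_Y v) i = of_nat i * Poly_Mapping.lookup v (i - 1)"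
proof (induction v rule: pm_induct)
  case (single a)
  then show ?case
    by (cases i) (auto simp: verma_Y_def lookup_single when_def simp del: single_one)
qed (simp_all add: verma_linear_simps lookup_add distrib_left mult.left_commute)

lemma lookup_verma_X:
  "Poly_Mapping.lookup (verma_X lam v) i = (lam - of_nat i) * Poly_Mapping.lookup v (Suc i)"
proof (induction v rule: pm_induct)
  case (single a)
  then show ?case
    by (cases a) (auto simp: verma_X_def lookup_single when_def simp del: single_one)
qed (simp_all add: verma_linear_simps lookup_add distrib_left mult.left_commute)

lemma linear_verma:
  "Vector_Spaces.linear pm_scale pm_scale (verma_X lam)"
  "Vector_Spaces.linear pm_scale pm_scale verma_Y"
  "Vector_Spaces.linear pm_scale pm_scale (verma_H lam)"
  unfolding verma_X_def verma_Y_def verma_H_def by (rule linear_lin_ext)+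

lemma verma_bracket_XY: "verma_X lam (verma_Y v) - verma_Y (verma_X lam v) = verma_H lam v"
proof (rule poly_mapping_eqI)
  fix i show "Poly_Mapping.lookup (verma_X lam (verma_Y v) - verma_Y (verma_X lam v)) i =
      Poly_Mapping.lookup (verma_H lam v) i"
    by (cases i)
      (simp_all add: lookup_minus lookup_verma_X lookup_verma_Y lookup_verma_H algebra_simps)
qed

lemma verma_bracket_HX: "verma_H lam (verma_X lam v) - verma_X lam (verma_H lam v) = pm_scale 2 (verma_X lam v)"
  by (rule poly_mapping_eqI)
    (simp add: lookup_minus lookup_verma_X lookup_verma_H algebra_simps)

lemma verma_bracket_HY: "verma_H lam (verma_Y v) - verma_Y (verma_H lam v) = pm_scale (- 2) (verma_Y v)"
proof (rule poly_mapping_eqI)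
  fix i show "Poly_Mapping.lookup (verma_H lam (verma_Y v) - verma_Y (verma_H lam v)) i =
      Poly_Mapping.lookup (pm_scale (- 2) (verma_Y v)) i"
    by (cases i) (simp_all add: lookup_minus lookup_verma_Y lookup_verma_H algebra_simps)
qed

interpretation verma: sl2_module pm_scale "verma_X lam" verma_Y "verma_H lam" for lam :: "'k::field"
  by (intro sl2_module.intro sl2_module_axioms.intro pm.vector_space_axioms linear_verma
      verma_bracket_XY verma_bracket_HX)
    (simp add: verma_bracket_HY)

interpretation ext_verma: sl2_module ext_scale
  "ext_deriv (verma_X lam)" "ext_deriv verma_Y" "ext_deriv (verma_H lam)" for lam :: "'k::field"
proof (intro sl2_module.intro sl2_module_axioms.intro ext.vector_space_axioms linear_ext_deriv)
  fix s :: "(nat, 'k) exterior_algebra"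
  show "ext_deriv (verma_X lam) (ext_deriv verma_Y s) - ext_deriv verma_Y (ext_deriv (verma_X lam) s) =
      ext_deriv (verma_H lam) s"
    using ext_deriv_commutator[OF linear_verma(1,2,3), of lam 1 lam s] by (simp add: verma_bracket_XY)
  show "ext_deriv (verma_H lam) (ext_deriv (verma_X lam) s) - ext_deriv (verma_X lam) (ext_deriv (verma_H lam) s) =
      ext_scale 2 (ext_deriv (verma_X lam) s)"
    using ext_deriv_commutator[OF linear_verma(3,1,1), of lam lam 2 lam s] by (simp add: verma_bracket_HX)
  show "ext_deriv (verma_H lam) (ext_deriv verma_Y s) - ext_deriv verma_Y (ext_deriv (verma_H lam) s) =
      - ext_scale 2 (ext_deriv verma_Y s)"
    using ext_deriv_commutator[OF linear_verma(3,2,2), of lam "- 2" s] by (simp add: verma_bracket_HY)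
qed

lemma verma_irreducible_iff:
  fixes lam :: "'k::field_char_0"
  shows "verma.irreducible lam UNIV \<longleftrightarrow> lam \<notin> \<nat>"
proof
  assume irr: "verma.irreducible lam UNIV"
  show "lam \<notin> \<nat>"
  proof
    assume "lam \<in> \<nat>"
    then obtain n where n: "lam = of_nat n" by (rule Nats_cases)
    define N where "N = {v :: nat \<Rightarrow>\<^sub>0 'k. \<forall>i\<le>n. Poly_Mapping.lookup v i = 0}"
    have "Poly_Mapping.lookup (verma_X lam v) i = 0" if "v \<in> N" "i \<le> n" for v i
      using that n by (cases "i = n") (simp_all add: lookup_verma_X N_def)
    moreover have "pm.subspace N"
      by (auto simp: pm.subspace_def N_def lookup_add)
    ultimately have "verma.submodule lam N"
      by (auto simp: verma.submodule_def N_def lookup_verma_Y lookup_verma_H)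
    with irr have "N = {0} \<or> N = UNIV" by (simp add: verma.irreducible_def)
    moreover have "verma_f (Suc n) \<in> N" by (simp add: N_def lookup_single)
    moreover have "verma_f (Suc n) \<noteq> (0 :: nat \<Rightarrow>\<^sub>0 'k)"
      by (metis lookup_single_eq lookup_zero zero_neq_one)
    moreover have "verma_f 0 \<notin> N" by (auto simp: N_def)
    ultimately show False by auto
  qed
next
  assume lam: "lam \<notin> \<nat>"
  have "N = UNIV" if N: "verma.submodule lam N" "N \<noteq> {0}" for N
  proof -
    have sub: "pm.subspace N" and X: "verma_X lam v \<in> N" and Y: "verma_Y v \<in> N" if "v \<in> N" for v
      using N(1) that by (auto simp: verma.submodule_def)
    have sub: "pm.subspace N" using N(1) by (simp add: verma.submodule_def)
    obtain v where v: "v \<in> N" "v \<noteq> 0"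
      using N(2) pm.subspace_0[OF sub] by auto
    have "verma_f 0 \<in> N" if "v \<in> N" "v \<noteq> 0" "Poly_Mapping.keys v \<subseteq> {..<n}" for v n
      using that
    proof (induction n arbitrary: v)
      case 0
      then show ?case by simp
    next
      case (Suc n)
      show ?case
      proof (cases "verma_X lam v = 0")
        case True
        have "Poly_Mapping.lookup v (Suc i) = 0" for i
          using arg_cong[OF True, of "\<lambda>p. Poly_Mapping.lookup p i"] lam
          by (auto simp: lookup_verma_X)
        then have ne: "Poly_Mapping.lookup v i = 0" if "i \<noteq> 0" for i
          using that by (cases i) auto
        then have v0: "Poly_Mapping.lookup v 0 \<noteq> 0"
          using Suc.prems(2) by (metis poly_mapping_eqI lookup_zero)
        have "verma_f 0 = pm_scale (1 / Poly_Mapping.lookup v 0) v"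
          by (rule poly_mapping_eqI) (use ne v0 in \<open>auto simp: lookup_single when_def simp del: single_one\<close>)
        then show ?thesis
          by (metis pm.subspace_scale[OF sub Suc.prems(1)])
      next
        case False
        have "Poly_Mapping.keys (verma_X lam v) \<subseteq> {..<n}"
          using Suc.prems(3) by (force simp: in_keys_iff lookup_verma_X)
        then show ?thesis
          using Suc.IH[OF X[OF Suc.prems(1)] False] by simp
      qed
    qed
    moreover obtain n where "Poly_Mapping.keys v \<subseteq> {..<n}"
      using finite_nat_set_iff_bounded[of "Poly_Mapping.keys v"] by auto
    ultimately have f0: "verma_f 0 \<in> N" using v by blast
    have f: "verma_f i \<in> N" for i
    proof (induction i)
      case (Suc i)
      have nz: "of_nat i + 1 \<noteq> (0 :: 'k)"
        by (metis of_nat_Suc of_nat_eq_0_iff nat.distinct(1) add.commute)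
      have "verma_f (Suc i) = pm_scale (1 / (of_nat i + 1 :: 'k)) (verma_Y (verma_f i))"
        using nz by (simp add: verma_Y_def)
      then show ?case
        using pm.subspace_scale[OF sub Y[OF Suc.IH]] by simp
    qed (rule f0)
    have "p \<in> N" for p
      by (induction p rule: pm_induct)
        (simp_all add: f sub pm.subspace_0 pm.subspace_add pm.subspace_scale)
    then show ?thesis by auto
  qed
  moreover have "verma.submodule lam UNIV"
    by (simp add: verma.submodule_def)
  moreover have "(UNIV :: (nat \<Rightarrow>\<^sub>0 'k) set) \<noteq> {0}"
    by (metis UNIV_I lookup_single_eq lookup_zero singletonD zero_neq_one)
  ultimately show "verma.irreducible lam UNIV"
    by (auto simp: verma.irreducible_def)
qed

definition verma_ft :: "'k \<Rightarrow> nat \<Rightarrow> (nat \<Rightarrow>\<^sub>0 'k::field)" where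
  "verma_ft lam i = pm_scale (1 / (\<Prod>l = 1..i. lam - of_nat l + 1)) (verma_f i)"

text \<open>
  Index tuples \<open>0 \<le> i\<^sub>1 < \<dots> < i\<^bsub>q-2\<^esub> < i\<close> are pairs \<open>(js, i)\<close> with \<open>js = [i\<^sub>1, \<dots>, i\<^bsub>q-2\<^esub>]\<close>.
\<close>

definition omega_index :: "nat \<Rightarrow> (nat list \<times> nat) set" where
  "omega_index q = {(js, i). length js = q - 2 \<and> sorted_wrt (<) (js @ [i])}"

definition omega_degree :: "nat list \<times> nat \<Rightarrow> nat" where
  "omega_degree = (\<lambda>(js, i). sum_list js + 2 * i + 1)"

text \<open>
  The sum over \<open>l\<close> has finite support, as \<open>X\<close> acts locally nilpotently; \<^const>\<open>Sum_any\<close> is the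
  sum over the support.
\<close>

definition omega :: "'k \<Rightarrow> nat list \<times> nat \<Rightarrow> (nat, 'k::field) exterior_algebra" where
  "omega lam = (\<lambda>(js, i). Sum_any (\<lambda>l. (- 1) ^ l *
     ((ext_deriv (verma_X lam) ^^ l) (wedge (map (verma_ft lam) (js @ [i]))) *
      ext_vec (verma_ft lam (i + 1 + l)))))"

text \<open>
  The vectors \<open>omega lam J\<close> have the weights \<open>q lam - 2 omega_degree J = m - 2 j\<close> with
  \<open>m = q lam - q (q - 1)\<close> and \<open>j \<ge> 0\<close>, and \<open>m\<close> occurs.  The submodules generated by them form a
  direct sum only if \<open>m\<close> is not a natural number: otherwise \<open>Y ^ (m + 1)\<close> maps the vector of weight
  \<open>m\<close> to a nonzero primitive vector, which is a combination of other vectors \<open>omega lam J\<close>.  For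
  \<open>q = 2\<close>, \<open>lam = 3/2\<close> one has
  \<open>Y (Y (omega lam ([], 0))) = ext_scale (3/2) (omega lam ([], 1))\<close>.
\<close>

definition num_partitions :: "nat \<Rightarrow> int \<Rightarrow> nat" where
  "num_partitions q N =
     card {xs :: int list. length xs = q \<and> sorted xs \<and> (\<forall>x\<in>set xs. 1 \<le> x) \<and> sum_list xs = N}"

end

theory Submission
  imports Defs
begin

text \<open>
  The idea is to compare leading terms with respect to the two largest indices.  By construction
  \<open>X\<close> annihilates \<open>omega lam (js, i)\<close>, which is the wedge product of the basis vectors with indices
  \<open>js, i, i + 1\<close> plus terms whose two largest indices are not consecutive.  So these vectors are
  linearly independent, and modulo their span every element of the exterior power is a combination
  of wedge products whose two largest indices are not consecutive.  On such combinations \<open>X\<close> is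
  injective: lowering the minimal largest index gives a term that nothing cancels.  This determines
  the primitive vectors.  Strictly increasing sequences become partitions on subtracting
  \<open>0, 1, 2, \<dots>\<close>, and those with nonconsecutive largest entries arise from the sequences of sum
  smaller by one, whence the difference of two partition numbers.  If no weight of a primitive
  vector is a natural number, then \<open>X ^ n Y ^ n\<close> acts on the primitive vectors by nonzero scalars; as
  \<open>X\<close> is locally nilpotent, this gives the decomposition.  The proper submodule is generated by a
  primitive vector whose weight is not the highest one.
\<close>

section \<open>Families of vectors and highest weight vectors\<close>

text \<open>Choosing one index for each vector of a finite combination moves the coefficients from
  vectors to indices, even where \<open>f\<close> is not injective.\<close>

lemma (in vector_space) span_image_obtain:
  assumes "x \<in> span (f ` I)"
  obtains A r where "finite A" "A \<subseteq> I" "x = (\<Sum>i\<in>A. scale (r i) (f i))"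
proof -
  from assms obtain t r where t: "finite t" "t \<subseteq> f ` I" "x = (\<Sum>a\<in>t. scale (r a) a)"
    unfolding span_explicit by blast
  from t(2) obtain A where A: "A \<subseteq> I" "inj_on f A" "t = f ` A"
    by (meson subset_image_inj)
  show thesis
    by (rule that[of A "\<lambda>i. r (f i)"]) (use t A finite_imageD in \<open>auto simp: sum.reindex\<close>)
qed

lemma (in vector_space) span_image_sum_mem:
  assumes "A \<subseteq> I"
  shows "(\<Sum>i\<in>A. scale (r i) (f i)) \<in> span (f ` I)"
  by (rule span_sum, rule span_scale, rule span_base) (use assms in auto)

lemma (in vector_space) linear_image_span_subset:
  assumes "Vector_Spaces.linear scale scale f" "x \<in> span B" "subspace S" "\<And>b. b \<in> B \<Longrightarrow> f b \<in> S"
  shows "f x \<in> S"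
proof -
  interpret f: Vector_Spaces.linear scale scale f by (rule assms(1))
  show ?thesis
    using assms(2)
    by (induction rule: span_induct_alt)
      (auto simp: f.zero f.add f.scale assms(3,4) subspace_0 subspace_add subspace_scale)
qed

text \<open>Independence is stated for the indexed family because the image set does not see
  repeated vectors, whereas injectivity and directness have to be derived too.\<close>

definition lin_indep_family :: "('k::field \<Rightarrow> 'v::ab_group_add \<Rightarrow> 'v) \<Rightarrow> ('i \<Rightarrow> 'v) \<Rightarrow> 'i set \<Rightarrow> bool" where
  "lin_indep_family s f I \<longleftrightarrow>
     (\<forall>A r. finite A \<and> A \<subseteq> I \<and> (\<Sum>i\<in>A. s (r i) (f i)) = 0 \<longrightarrow> (\<forall>i\<in>A. r i = 0))"

lemma (in vector_space) lin_indep_familyD: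
  assumes "lin_indep_family scale f I" "finite A" "A \<subseteq> I" "(\<Sum>i\<in>A. scale (r i) (f i)) = 0" "i \<in> A"
  shows "r i = 0"
  using assms unfolding lin_indep_family_def by blast

lemma (in vector_space) lin_indep_family_inj:
  assumes "lin_indep_family scale f I"
  shows "inj_on f I"
proof (rule inj_onI, rule ccontr)
  fix i j assume ij: "i \<in> I" "j \<in> I" "f i = f j" "i \<noteq> j"
  have "(\<Sum>h\<in>{i, j}. scale (if h = i then 1 else - 1) (f h)) = 0"
    using ij by simp
  from lin_indep_familyD[OF assms _ _ this, of i] show False using ij by auto
qed

lemma (in vector_space) lin_indep_family_independent:
  assumes "lin_indep_family scale f I"
  shows "independent (f ` I)"
  unfolding independent_explicit_module
proof (intro allI impI)
  fix t u v assume t: "finite t" "t \<subseteq> f ` I" "(\<Sum>v\<in>t. scale (u v) v) = 0" "v \<in> t"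
  from t(2) obtain A where A: "A \<subseteq> I" "inj_on f A" "t = f ` A"
    by (meson subset_image_inj)
  then obtain i where i: "i \<in> A" "v = f i" using t by auto
  have "(\<Sum>i\<in>A. scale (u (f i)) (f i)) = 0" using t A by (simp add: sum.reindex)
  with lin_indep_familyD[OF assms _ A(1) this i(1)] show "u v = 0"
    using t A i finite_imageD by auto
qed

lemma (in vector_space) lin_indep_family_subset:
  "lin_indep_family scale f I \<Longrightarrow> J \<subseteq> I \<Longrightarrow> lin_indep_family scale f J"
  unfolding lin_indep_family_def by blast

text \<open>Applying \<open>c i\<close> to a vanishing combination isolates the coefficient of
  \<open>f i\<close>. The value \<open>c i (f i)\<close> is left unnormalized, so that signs and
  scalars of leading terms need not be computed.\<close>

lemma (in vector_space) lin_indep_family_dual: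
  assumes c: "\<And>i. i \<in> I \<Longrightarrow> Vector_Spaces.linear scale (*) (c i)"
    and nz: "\<And>i. i \<in> I \<Longrightarrow> c i (f i) \<noteq> 0"
    and z: "\<And>i j. i \<in> I \<Longrightarrow> j \<in> I \<Longrightarrow> i \<noteq> j \<Longrightarrow> c i (f j) = 0"
  shows "lin_indep_family scale f I"
  unfolding lin_indep_family_def
proof (intro allI impI ballI)
  fix A r i assume *: "finite A \<and> A \<subseteq> I \<and> (\<Sum>i\<in>A. scale (r i) (f i)) = 0" and i: "i \<in> A"
  then have iI: "i \<in> I" by auto
  interpret ci: Vector_Spaces.linear scale "(*)" "c i" by (rule c[OF iI])
  have "0 = c i (\<Sum>j\<in>A. scale (r j) (f j))" using * by simp
  also have "\<dots> = (\<Sum>j\<in>A. r j * c i (f j))" by (simp add: ci.sum ci.scale)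
  also have "\<dots> = (\<Sum>j\<in>A. if j = i then r i * c i (f i) else 0)"
    by (rule sum.cong) (use * iI z in \<open>auto simp: subset_iff\<close>)
  also have "\<dots> = r i * c i (f i)" using * i by simp
  finally show "r i = 0" using nz[OF iI] by simp
qed

section \<open>Primitive vectors and the submodules they generate\<close>

context sl2_module
begin

sublocale X: Vector_Spaces.linear scale scale X by (rule linear_X)
sublocale Y: Vector_Spaces.linear scale scale Y by (rule linear_Y)
sublocale H: Vector_Spaces.linear scale scale H by (rule linear_H)

lemma X_pow_add: "(X ^^ n) (v + w) = (X ^^ n) v + (X ^^ n) w"
  by (induction n) (simp_all add: X.add)

lemma X_pow_scale: "(X ^^ n) (scale c v) = scale c ((X ^^ n) v)"
  by (induction n) (simp_all add: X.scale)

lemma X_pow_0: "(X ^^ n) 0 = 0"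
  by (induction n) (simp_all add: X.zero)

lemma linear_X_pow: "Vector_Spaces.linear scale scale (X ^^ n)"
  by unfold_locales (simp_all add: X_pow_add X_pow_scale)

lemma submoduleD:
  assumes "submodule N"
  shows "subspace N" "v \<in> N \<Longrightarrow> X v \<in> N" "v \<in> N \<Longrightarrow> Y v \<in> N" "v \<in> N \<Longrightarrow> H v \<in> N"
  using assms by (auto simp: submodule_def)

lemma submodule_pow:
  assumes "submodule N" "v \<in> N"
  shows "(X ^^ n) v \<in> N" "(Y ^^ n) v \<in> N"
  using assms by (induction n) (auto simp: submoduleD)

lemma submodule_generated: "submodule (generated v)"
proof -
  \<comment> \<open>Submodules are closed under intersection, so the hull is itself a
    submodule.\<close>
  have "submodule (\<Inter>T)" if "\<And>N. N \<in> T \<Longrightarrow> submodule N" for T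
    using that by (auto simp: submodule_def subspace_def image_subset_iff)
  then show ?thesis
    unfolding generated_def by (rule hull_in) blast
qed

lemma generated_self: "v \<in> generated v"
  using hull_subset[of "{v}" submodule] by (auto simp: generated_def)

lemma generated_minimal: "submodule N \<Longrightarrow> v \<in> N \<Longrightarrow> generated v \<subseteq> N"
  unfolding generated_def by (rule hull_minimal) auto

lemma H_Y_pow:
  assumes "H v = scale \<mu> v"
  shows "H ((Y ^^ n) v) = scale (\<mu> - 2 * of_nat n) ((Y ^^ n) v)"
proof (induction n)
  case (Suc n)
  have "H (Y ((Y ^^ n) v)) = Y (H ((Y ^^ n) v)) - scale 2 (Y ((Y ^^ n) v))"
    using bracket_HY[of "(Y ^^ n) v"] by (simp add: algebra_simps)
  then show ?case
    by (simp add: Suc Y.scale algebra_simps flip: scale_left_diff_distrib)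
qed (simp add: assms)

text \<open>Commuting \<open>X\<close> past each \<open>Y\<close> costs one \<open>H\<close>; the
  eigenvalues \<open>\<mu> - 2 j\<close> for \<open>j = 0, ..., n\<close> add up to the
  scalar.\<close>

lemma X_Y_pow:
  assumes "X v = 0" "H v = scale \<mu> v"
  shows "X ((Y ^^ Suc n) v) = scale (of_nat (Suc n) * (\<mu> - of_nat n)) ((Y ^^ n) v)"
proof (induction n)
  case 0
  show ?case using bracket_XY[of v] by (simp add: assms Y.zero)
next
  case (Suc n)
  have "X (Y ((Y ^^ Suc n) v)) = H ((Y ^^ Suc n) v) + Y (X ((Y ^^ Suc n) v))"
    using bracket_XY[of "(Y ^^ Suc n) v"] by (simp only: diff_eq_eq)
  also have "\<dots> = scale (\<mu> - 2 * of_nat (Suc n) + of_nat (Suc n) * (\<mu> - of_nat n)) ((Y ^^ Suc n) v)"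
    unfolding Suc H_Y_pow[OF assms(2)] by (simp add: Y.scale scale_left_distrib)
  also have "\<mu> - 2 * of_nat (Suc n) + of_nat (Suc n) * (\<mu> - of_nat n) =
      of_nat (Suc (Suc n)) * (\<mu> - of_nat (Suc n))"
    by (simp add: algebra_simps)
  finally show ?case by simp
qed

text \<open>Peeling off one \<open>X\<close> and one \<open>Y\<close> at a time multiplies the
  scalars of \<open>X_Y_pow\<close>. In characteristic zero the product vanishes only if
  \<open>\<mu>\<close> is one of \<open>0, ..., n - 1\<close>.\<close>

lemma X_pow_Y_pow:
  assumes "X v = 0" "H v = scale \<mu> v"
  shows "(X ^^ n) ((Y ^^ n) v) = scale (\<Prod>t<n. of_nat (Suc t) * (\<mu> - of_nat t)) v"
proof (induction n)
  case (Suc n)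
  have "(X ^^ Suc n) ((Y ^^ Suc n) v) = (X ^^ n) (X ((Y ^^ Suc n) v))"
    by (simp only: funpow_Suc_right o_apply)
  then show ?case
    unfolding X_Y_pow[OF assms] X_pow_scale Suc by (simp add: mult.commute)
qed simp

text \<open>The first \<open>n\<close> factors \<open>X\<close> lead back to a multiple of
  \<open>v\<close>, and the next one annihilates it.\<close>

lemma X_pow_Y_pow_less:
  assumes "X v = 0" "H v = scale \<mu> v" "n < m"
  shows "(X ^^ m) ((Y ^^ n) v) = 0"
proof -
  have "(X ^^ (m - n - 1)) (X ((X ^^ n) w)) = (X ^^ ((m - n - 1) + Suc n)) w" for w
    by (simp only: funpow_add o_apply funpow.simps(2))
  with assms(3) have "(X ^^ m) w = (X ^^ (m - n - 1)) (X ((X ^^ n) w))" for w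
    by simp
  then show ?thesis
    by (simp add: X_pow_Y_pow[OF assms(1,2)] X.scale assms(1) X_pow_0)
qed

text \<open>\<open>X\<close> sends each \<open>(Y ^^ n) v\<close> to a multiple of the preceding one
  or to \<open>0\<close>, and \<open>H\<close> to a multiple of itself, so the span is already
  stable.\<close>

lemma generated_primitive:
  assumes "X v = 0" "H v = scale \<mu> v"
  shows "generated v = span (range (\<lambda>n. (Y ^^ n) v))" (is "_ = ?S")
proof
  have closed: "D x \<in> ?S" if D: "Vector_Spaces.linear scale scale D"
    and "\<And>n. D ((Y ^^ n) v) \<in> ?S" and "x \<in> ?S" for D x
  proof -
    interpret D: Vector_Spaces.linear scale scale D by (rule D)
    show ?thesis
      using that(3)
      by (induction rule: span_induct_alt)
        (auto simp: D.zero D.add D.scale that(2) span_zero span_add span_scale)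
  qed
  have "submodule ?S"
    unfolding submodule_def image_subset_iff
  proof (intro conjI ballI)
    fix x assume x: "x \<in> ?S"
    show "X x \<in> ?S"
    proof (rule closed[OF linear_X _ x])
      fix n show "X ((Y ^^ n) v) \<in> ?S"
      proof (cases n)
        case (Suc m)
        show ?thesis unfolding Suc X_Y_pow[OF assms] by (intro span_scale span_base) auto
      qed (simp add: assms span_zero)
    qed
    show "Y x \<in> ?S"
      by (rule closed[OF linear_Y _ x], rule span_base) (metis funpow.simps(2) o_apply rangeI)
    show "H x \<in> ?S"
      by (rule closed[OF linear_H _ x]) (simp add: H_Y_pow[OF assms(2)] span_scale span_base)
  qed simp
  then show "generated v \<subseteq> ?S"
    by (rule generated_minimal) (metis span_base rangeI funpow_0)
  show "?S \<subseteq> generated v"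
    by (rule span_minimal)
      (auto intro: submodule_pow submodule_generated generated_self submoduleD(1))
qed

text \<open>
  The hypothesis on the weights says that the vectors generate irreducible Verma modules, so that
  \<open>X ^ n\<close> maps \<open>Y ^ n w\<close> to a nonzero multiple of \<open>w\<close>.  Applying a power of \<open>X\<close> thus reduces both
  directness and exhaustion to statements about the kernel of \<open>X\<close>.
\<close>

theorem direct_sum_of_generated:
  assumes M: "submodule M" and w: "\<And>i. i \<in> I \<Longrightarrow> w i \<in> M"
    and prim: "\<And>i. i \<in> I \<Longrightarrow> X (w i) = 0" "\<And>i. i \<in> I \<Longrightarrow> H (w i) = scale (\<mu> i) (w i)"
    and weights: "\<And>i t. i \<in> I \<Longrightarrow> of_nat (Suc t) * (\<mu> i - of_nat t) \<noteq> 0"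
    and indep: "lin_indep_family scale w I"
    and ker: "\<And>v. v \<in> M \<Longrightarrow> X v = 0 \<Longrightarrow> v \<in> span (w ` I)"
    and nilp: "\<And>v. v \<in> M \<Longrightarrow> \<exists>n. (X ^^ n) v = 0"
  shows "direct_sum_of_submodules M I (\<lambda>i. generated (w i))"
proof -
  define c where "c i n = (\<Prod>t<n. of_nat (Suc t) * (\<mu> i - of_nat t))" for i and n :: nat
  have c: "c i n \<noteq> 0" if "i \<in> I" for i n
    using weights[OF that] unfolding c_def by (subst prod_zero_iff) auto
  have XY: "(X ^^ n) ((Y ^^ n) (w i)) = scale (c i n) (w i)" if "i \<in> I" for i n
    unfolding c_def by (rule X_pow_Y_pow) (use that prim in auto)
  let ?U = "span (\<Union>i\<in>I. generated (w i))"
  have "v \<in> ?U" if "v \<in> M" "(X ^^ n) v = 0" for v n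
    using that
  proof (induction n arbitrary: v)
    case 0
    then show ?case by (simp add: span_zero)
  next
    case (Suc n)
    have "(X ^^ n) v \<in> span (w ` I)"
      using Suc.prems by (intro ker submodule_pow[OF M]) auto
    then obtain A r where A: "finite A" "A \<subseteq> I" "(X ^^ n) v = (\<Sum>i\<in>A. scale (r i) (w i))"
      by (rule span_image_obtain)
    \<comment> \<open>Dividing by \<open>c i n\<close> makes \<open>(X ^^ n) u = (X ^^ n) v\<close>,
      so that the induction hypothesis applies to \<open>v - u\<close>.\<close>
    define u where "u = (\<Sum>i\<in>A. scale (r i / c i n) ((Y ^^ n) (w i)))"
    interpret Xn: Vector_Spaces.linear scale scale "X ^^ n" by (rule linear_X_pow)
    have "(X ^^ n) u = (\<Sum>i\<in>A. scale (r i) (w i))"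
      unfolding u_def Xn.sum Xn.scale
      by (rule sum.cong) (use A c XY in \<open>auto simp: subset_iff\<close>)
    then have "(X ^^ n) (v - u) = 0" by (simp add: Xn.diff A)
    moreover have "u \<in> M"
      unfolding u_def using A w submodule_pow(2)[OF M] submoduleD(1)[OF M]
      by (intro subspace_sum subspace_scale) auto
    ultimately have "v - u \<in> ?U"
      using Suc.prems submoduleD(1)[OF M] by (intro Suc.IH subspace_diff) auto
    moreover have "u \<in> ?U"
      unfolding u_def using A
      by (intro span_sum span_scale span_base)
        (auto intro: submodule_pow submodule_generated generated_self)
    ultimately show ?case using span_add[of "v - u" _ u] by simp
  qed
  then have "M \<subseteq> ?U" using nilp by blast
  moreover have "?U \<subseteq> M"
    by (rule span_minimal) (use M w generated_minimal submoduleD(1) in blast)+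
  moreover have "\<forall>j\<in>J. f j = 0"
    if J: "finite J" "J \<subseteq> I" and f: "\<And>j. j \<in> J \<Longrightarrow> f j \<in> generated (w j)"
      and s: "(\<Sum>j\<in>J. f j) = 0" for J f
  proof -
    have "\<exists>a N. finite N \<and> f j = (\<Sum>n\<in>N. scale (a n) ((Y ^^ n) (w j)))" if "j \<in> J" for j
    proof -
      have "f j \<in> span (range (\<lambda>n. (Y ^^ n) (w j)))"
        using f[OF that] generated_primitive[OF prim] that J by auto
      then show ?thesis by (rule span_image_obtain) blast
    qed
    then obtain a N where fin: "\<And>j. j \<in> J \<Longrightarrow> finite (N j)"
      and fj: "\<And>j. j \<in> J \<Longrightarrow> f j = (\<Sum>n\<in>N j. scale (a j n) ((Y ^^ n) (w j)))"
      by metis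
    \<comment> \<open>Padding with zeros gives all sums the common range \<open>n < m\<close>, which
      permits an induction on \<open>m\<close>.\<close>
    define b where "b j n = (if n \<in> N j then a j n else 0)" for j n
    have "finite (\<Union>j\<in>J. N j)" using J fin by auto
    then obtain m where m: "(\<Union>j\<in>J. N j) \<subseteq> {..<m}"
      by (auto simp: finite_nat_set_iff_bounded)
    have fb: "f j = (\<Sum>n<m. scale (b j n) ((Y ^^ n) (w j)))" if "j \<in> J" for j
      unfolding fj[OF that] using m that
      by (intro sum.mono_neutral_cong_left) (auto simp: b_def)
    have "\<forall>j\<in>J. (\<Sum>n<m. scale (b j n) ((Y ^^ n) (w j))) = 0"
      if "(\<Sum>j\<in>J. \<Sum>n<m. scale (b j n) ((Y ^^ n) (w j))) = 0" for m
      using that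
    proof (induction m)
      case (Suc m)
      interpret Xm: Vector_Spaces.linear scale scale "X ^^ m" by (rule linear_X_pow)
      \<comment> \<open>\<open>X ^^ m\<close> kills the terms with exponent below \<open>m\<close>
        and exposes the top coefficients, which vanish by independence of the vectors
        \<open>w j\<close>.\<close>
      have "0 = (X ^^ m) (\<Sum>j\<in>J. \<Sum>n<Suc m. scale (b j n) ((Y ^^ n) (w j)))"
        using Suc.prems by (simp add: Xm.zero)
      also have "\<dots> = (\<Sum>j\<in>J. \<Sum>n<Suc m. scale (b j n) ((X ^^ m) ((Y ^^ n) (w j))))"
        by (simp only: Xm.sum Xm.scale)
      also have "\<dots> = (\<Sum>j\<in>J. scale (b j m * c j m) (w j))"
      proof (rule sum.cong[OF refl])
        fix j assume "j \<in> J"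
        then have j: "j \<in> I" using J by auto
        have "(\<Sum>n<m. scale (b j n) ((X ^^ m) ((Y ^^ n) (w j)))) = 0"
          by (rule sum.neutral) (auto simp: X_pow_Y_pow_less[OF prim[OF j]])
        then show "(\<Sum>n<Suc m. scale (b j n) ((X ^^ m) ((Y ^^ n) (w j)))) = scale (b j m * c j m) (w j)"
          by (simp add: XY[OF j])
      qed
      finally have bm: "b j m = 0" if "j \<in> J" for j
        using lin_indep_familyD[OF indep J, of "\<lambda>j. b j m * c j m" j] c that J by auto
      with Suc show ?case by simp
    qed simp
    with s show ?thesis by (simp add: fb cong: sum.cong)
  qed
  ultimately show ?thesis
    unfolding direct_sum_of_submodules_def by (auto simp: submodule_generated)
qed

end

section \<open>Coordinates in the exterior algebra\<close>

text \<open>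
  The finite set \<open>S\<close> stands for the wedge product of its elements in increasing order.  The action of
  the tensor algebra on such formal wedge products factors through the exterior algebra, which shows
  that the actual ones are linearly independent.
\<close>

definition grassmann_mult :: "nat \<Rightarrow> (nat set \<Rightarrow>\<^sub>0 'k) \<Rightarrow> (nat set \<Rightarrow>\<^sub>0 'k::field)" where
  "grassmann_mult a = lin_ext (\<lambda>S. if a \<in> S then 0
     else Poly_Mapping.single (insert a S) ((- 1) ^ card {s \<in> S. s < a}))"

lemma grassmann_mult_linear:
  "grassmann_mult a (x + y) = grassmann_mult a x + grassmann_mult a y"
  "grassmann_mult a (pm_scale c x) = pm_scale c (grassmann_mult a x)"
  "grassmann_mult a 0 = 0"
  by (simp_all add: grassmann_mult_def lin_ext_add lin_ext_scale)

lemma grassmann_mult_single: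
  "grassmann_mult a (Poly_Mapping.single S c) = (if a \<in> S then 0
     else Poly_Mapping.single (insert a S) (c * (- 1) ^ card {s \<in> S. s < a}))"
  by (simp add: grassmann_mult_def)

lemma card_less_insert:
  fixes a b :: nat
  assumes "b \<notin> S"
  shows "card {s. (s = b \<or> s \<in> S) \<and> s < a} = (if b < a then Suc (card {s \<in> S. s < a}) else card {s \<in> S. s < a})"
proof (cases "b < a")
  case True
  then have "{s. (s = b \<or> s \<in> S) \<and> s < a} = insert b {s \<in> S. s < a}" by auto
  with True assms show ?thesis by simp
next
  case False
  then have "{s. (s = b \<or> s \<in> S) \<and> s < a} = {s \<in> S. s < a}" by auto
  with False show ?thesis by simp
qed

text \<open>For distinct \<open>a\<close> and \<open>b\<close> the smaller one is counted in the
  sign of the larger exactly when it is inserted first, so the two orders give opposite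
  signs.\<close>

lemma grassmann_mult_anticommute:
  "grassmann_mult a (grassmann_mult b x) + grassmann_mult b (grassmann_mult a x) = 0"
proof (induction x rule: pm_induct)
  case (single S)
  show ?case
    by (auto simp: grassmann_mult_single grassmann_mult_linear card_less_insert insert_commute
        simp flip: single_add)
next
  case (add p q c)
  have "grassmann_mult a (grassmann_mult b p) = - grassmann_mult b (grassmann_mult a p)"
    "grassmann_mult a (grassmann_mult b q) = - grassmann_mult b (grassmann_mult a q)"
    using add by (simp_all add: eq_neg_iff_add_eq_0)
  then show ?case
    by (simp add: grassmann_mult_linear)
qed (simp add: grassmann_mult_linear)

text \<open>In characteristic two this does not follow from anticommutativity.\<close>

lemma grassmann_mult_square: "grassmann_mult a (grassmann_mult a x) = 0"
  by (induction x rule: pm_induct) (auto simp: grassmann_mult_single grassmann_mult_linear)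

text \<open>The algebra homomorphism from the tensor algebra to the endomorphisms that extends
  \<open>grassmann_mult\<close>. With \<open>foldr\<close> the first letter acts last, so
  concatenation becomes composition.\<close>

definition tens_act :: "(nat, 'k) tensor_algebra \<Rightarrow> (nat set \<Rightarrow>\<^sub>0 'k) \<Rightarrow> (nat set \<Rightarrow>\<^sub>0 'k::field)" where
  "tens_act s x = lin_ext (\<lambda>w. foldr grassmann_mult w x) s"

lemma tens_act_linear:
  "tens_act (s + t) x = tens_act s x + tens_act t x"
  "tens_act (pm_scale c s) x = pm_scale c (tens_act s x)"
  "tens_act 0 x = 0"
  by (simp_all add: tens_act_def lin_ext_add lin_ext_scale)

lemma tens_act_single: "tens_act (Poly_Mapping.single w c) x = pm_scale c (foldr grassmann_mult w x)"
  by (simp add: tens_act_def)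

lemma foldr_grassmann_mult_linear:
  "foldr grassmann_mult w (x + y) = foldr grassmann_mult w x + foldr grassmann_mult w y"
  "foldr grassmann_mult w (pm_scale c x) = pm_scale c (foldr grassmann_mult w x)"
  "foldr grassmann_mult w 0 = 0"
  by (induction w) (simp_all add: grassmann_mult_linear)

lemma tens_act_linear_right:
  "tens_act s (x + y) = tens_act s x + tens_act s y"
  "tens_act s (pm_scale c x) = pm_scale c (tens_act s x)"
  "tens_act s 0 = 0"
proof -
  show "tens_act s (x + y) = tens_act s x + tens_act s y"
    by (induction s rule: pm_induct)
      (simp_all add: tens_act_linear tens_act_single foldr_grassmann_mult_linear pm.scale_right_distrib add_ac)
  show "tens_act s (pm_scale c x) = pm_scale c (tens_act s x)"
    by (induction s rule: pm_induct)
      (simp_all add: tens_act_linear tens_act_single foldr_grassmann_mult_linear pm.scale_right_distrib mult.commute)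
  show "tens_act s 0 = 0"
    by (induction s rule: pm_induct)
      (simp_all add: tens_act_linear tens_act_single foldr_grassmann_mult_linear)
qed

lemma tens_act_mult: "tens_act (s * t) x = tens_act s (tens_act t x)"
proof (induction s rule: pm_induct)
  case (single u)
  show ?case
    by (induction t rule: pm_induct)
      (simp_all add: mult_single plus_list_def tens_act_single tens_act_linear
        foldr_grassmann_mult_linear distrib_left pm_scale_mult_right)
qed (simp_all add: tens_act_linear distrib_right pm_scale_mult_left)

lemma tens_act_vec_anticommute:
  "tens_act (tens_vec u) (tens_act (tens_vec v) x) + tens_act (tens_vec v) (tens_act (tens_vec u) x) = 0"
proof (induction u rule: pm_induct)
  case (single a)
  show ?case
  proof (induction v rule: pm_induct)
    case (single b)
    then show ?case by (simp add: tens_vec_sum tens_act_single grassmann_mult_anticommute)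
  next
    case (add p q c)
    from add have "tens_act (tens_vec (verma_f a)) (tens_act (tens_vec p) x) =
        - tens_act (tens_vec p) (tens_act (tens_vec (verma_f a)) x)"
      "tens_act (tens_vec (verma_f a)) (tens_act (tens_vec q) x) =
        - tens_act (tens_vec q) (tens_act (tens_vec (verma_f a)) x)"
      by (simp_all add: eq_neg_iff_add_eq_0)
    then show ?case
      by (simp add: tens_vec_sum(1,2) tens_act_linear tens_act_linear_right)
  qed (simp add: tens_vec_sum(3) tens_act_linear tens_act_linear_right)
next
  case (add p q c)
  from add have "tens_act (tens_vec p) (tens_act (tens_vec v) x) = - tens_act (tens_vec v) (tens_act (tens_vec p) x)"
    "tens_act (tens_vec q) (tens_act (tens_vec v) x) = - tens_act (tens_vec v) (tens_act (tens_vec q) x)"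
    by (simp_all add: eq_neg_iff_add_eq_0)
  then show ?case
    by (simp add: tens_vec_sum tens_act_linear tens_act_linear_right)
qed (simp add: tens_vec_sum tens_act_linear tens_act_linear_right)

text \<open>Squaring is quadratic in \<open>v\<close>, so the inductive step leaves two mixed terms,
  which cancel by anticommutativity.\<close>

lemma tens_act_vec_square: "tens_act (tens_vec v) (tens_act (tens_vec v) x) = 0"
proof (induction v rule: pm_induct)
  case (single a)
  then show ?case by (simp add: tens_vec_sum(4) tens_act_single grassmann_mult_square)
next
  case (add p q c)
  have "tens_act (tens_vec p) (tens_act (tens_vec q) x) = - tens_act (tens_vec q) (tens_act (tens_vec p) x)"
    using tens_act_vec_anticommute[of p q x] by (simp add: eq_neg_iff_add_eq_0)
  with add show ?case
    by (simp add: tens_vec_sum tens_act_linear tens_act_linear_right)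
qed (simp add: tens_vec_sum(3) tens_act_linear)

lemma tens_act_ideal:
  assumes "s \<in> ext_ideal" shows "tens_act s x = 0"
  using assms unfolding ext_ideal_def
  by (induction s rule: pm.span_induct_alt)
    (auto simp: tens_act_linear tens_act_mult tens_act_vec_square tens_act_linear_right)

text \<open>The empty set is the formal unit; acting on it turns an element into its coordinates.
  The ideal acts by zero, so this is well defined.\<close>

lift_definition ext_coords :: "(nat, 'k::field) exterior_algebra \<Rightarrow> (nat set \<Rightarrow>\<^sub>0 'k)"
  is "\<lambda>s. tens_act s (Poly_Mapping.single {} 1)"
proof -
  fix s t :: "(nat, 'k) tensor_algebra"
  assume "ext_rel s t"
  then have "tens_act (s - t) (Poly_Mapping.single {} 1) = 0"
    unfolding ext_rel_def by (rule tens_act_ideal)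
  then show "tens_act s (Poly_Mapping.single {} 1) = tens_act t (Poly_Mapping.single {} 1)"
    using tens_act_linear(1)[of "s - t" t "Poly_Mapping.single {} 1"] by simp
qed

lemma ext_coords_linear:
  "ext_coords (x + y) = ext_coords x + ext_coords y"
  "ext_coords (ext_scale c x) = pm_scale c (ext_coords x)"
  by (transfer; simp add: tens_act_linear)+

lemma ext_coords_one: "ext_coords 1 = Poly_Mapping.single {} 1"
  by transfer (simp add: tens_act_single flip: single_Nil)

lemma ext_coords_basis_mult:
  "ext_coords (ext_vec (verma_f a) * x) = grassmann_mult a (ext_coords x)"
  by transfer (simp add: tens_act_mult tens_vec_sum tens_act_single)

section \<open>Calculus with wedge products and derivations\<close>

lemma ext_vec_linear:
  "ext_vec (v + w) = ext_vec v + ext_vec w"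
  "ext_vec (pm_scale c v) = ext_scale c (ext_vec v)"
  "ext_vec 0 = 0"
  by (transfer; simp add: tens_vec_sum ext_rel_refl)+

lemma ext_scale_mult_left: "ext_scale c x * y = ext_scale c (x * y)"
  by transfer (simp add: pm_scale_mult_left ext_rel_refl)

lemma ext_scale_mult_right: "x * ext_scale c y = ext_scale c (x * y)"
  by transfer (simp add: pm_scale_mult_right ext_rel_refl)

lemma linear_ext_coord:
  "Vector_Spaces.linear ext_scale (*) (\<lambda>v. Poly_Mapping.lookup (ext_coords v) S)"
  by unfold_locales (simp_all add: ext_coords_linear lookup_add algebra_simps)

text \<open>Polarization of \<open>ext_vec_square\<close>.\<close>

lemma ext_vec_anticommute: "ext_vec v * ext_vec w = - (ext_vec w * ext_vec v)"
proof -
  have "ext_vec (v + w) * ext_vec (v + w) = 0" by (rule ext_vec_square)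
  then show ?thesis
    by (simp add: ext_vec_linear distrib_left distrib_right ext_vec_square eq_neg_iff_add_eq_0 add.commute)
qed

lemma wedge_simps: "wedge [] = 1" "wedge (v # vs) = ext_vec v * wedge vs"
  "wedge (vs @ ws) = wedge vs * wedge ws"
  by (simp_all add: wedge_def)

lemma wedge_in_ext_power: "length vs = q \<Longrightarrow> wedge vs \<in> ext_power q"
  unfolding ext_power_def by (rule ext.span_base) blast

lemma ext_power_Cons: "x \<in> ext_power q \<Longrightarrow> ext_vec v * x \<in> ext_power (Suc q)"
  unfolding ext_power_def[of q]
proof (induction rule: ext.span_induct_alt)
  case base
  then show ?case by (simp add: ext_power_def ext.span_zero)
next
  case (step c x y)
  then obtain vs where "x = wedge vs" "length vs = q" by blast
  then have "ext_vec v * x \<in> ext_power (Suc q)"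
    using wedge_in_ext_power[of "v # vs" "Suc q"] by (simp add: wedge_simps)
  with step show ?case
    by (simp add: distrib_left ext_scale_mult_right ext_power_def ext.span_add ext.span_scale)
qed

lemma ext_deriv_linear_simps:
  "ext_deriv D (x + y) = ext_deriv D x + ext_deriv D y"
  "ext_deriv D (x - y) = ext_deriv D x - ext_deriv D y"
  "ext_deriv D (- x) = - ext_deriv D x"
  "ext_deriv D (ext_scale c x) = ext_scale c (ext_deriv D x)"
  "ext_deriv D (sum g A) = (\<Sum>a\<in>A. ext_deriv D (g a))"
  "ext_deriv D 0 = 0"
proof -
  interpret D: Vector_Spaces.linear ext_scale ext_scale "ext_deriv D" by (rule linear_ext_deriv)
  show "ext_deriv D (x + y) = ext_deriv D x + ext_deriv D y"
    "ext_deriv D (x - y) = ext_deriv D x - ext_deriv D y"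
    "ext_deriv D (- x) = - ext_deriv D x"
    "ext_deriv D (ext_scale c x) = ext_scale c (ext_deriv D x)"
    "ext_deriv D (sum g A) = (\<Sum>a\<in>A. ext_deriv D (g a))"
    "ext_deriv D 0 = 0"
    by (rule D.add D.diff D.neg D.scale D.sum D.zero)+
qed

lemma ext_deriv_one: "ext_deriv D 1 = 0"
  by transfer (simp add: tens_deriv_one ext_rel_refl)

lemma ext_deriv_wedge:
  assumes "Vector_Spaces.linear pm_scale pm_scale D"
  shows "ext_deriv D (wedge vs) \<in> ext_power (length vs)"
proof (induction vs)
  case Nil
  then show ?case by (simp add: wedge_simps ext_deriv_one ext_power_def ext.span_zero)
next
  case (Cons v vs)
  have "ext_vec (D v) * wedge vs \<in> ext_power (Suc (length vs))"
    by (intro ext_power_Cons wedge_in_ext_power refl)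
  with ext_power_Cons[OF Cons, of v] show ?case
    by (simp add: wedge_simps ext_deriv_mult ext_deriv_vec[OF assms] ext_power_def ext.span_add)
qed

lemma ext_deriv_ext_power:
  assumes "Vector_Spaces.linear pm_scale pm_scale D" "x \<in> ext_power q"
  shows "ext_deriv D x \<in> ext_power q"
  using assms(2) unfolding ext_power_def[of q]
proof (induction rule: ext.span_induct_alt)
  case (step c x y)
  then show ?case
    using ext_deriv_wedge[OF assms(1)]
    by (auto simp: ext_deriv_linear_simps ext_power_def intro!: ext.span_add ext.span_scale)
qed (simp add: ext_deriv_linear_simps ext.span_zero)

lemma submodule_ext_power: "ext_verma.submodule lam (ext_power q)"
  by (auto simp: ext_verma.submodule_def ext_power_def[of q] intro: ext_deriv_ext_power[unfolded ext_power_def] linear_verma)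

lemma linear_ext_mult:
  "Vector_Spaces.linear ext_scale ext_scale (\<lambda>x. y * x)"
  "Vector_Spaces.linear ext_scale ext_scale (\<lambda>x. x * y)"
  by unfold_locales (simp_all add: distrib_left distrib_right ext_scale_mult_left ext_scale_mult_right)

text \<open>The signs in \<open>omega\<close> are elements of the algebra rather than scalars; by
  parity they reduce to a negation.\<close>

lemma neg_one_power_mult_mem:
  fixes x :: "('a, 'k::field) exterior_algebra"
  assumes "ext.subspace S" "x \<in> S"
  shows "(- 1) ^ l * x \<in> S"
  using assms by (cases "even l") (auto simp: ext.subspace_neg)

lemma ext_deriv_neg_one_power_mult: "ext_deriv D ((- 1) ^ l * x) = (- 1) ^ l * ext_deriv D x"
  by (cases "even l") (simp_all add: ext_deriv_linear_simps)

section \<open>Counting strictly increasing sequences\<close>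

text \<open>These lists index the sorted wedge products of degree \<open>k\<close>. The degree is an
  integer so that passing to \<open>k - 1\<close> involves no truncation.\<close>

definition strict_lists :: "nat \<Rightarrow> int \<Rightarrow> nat list set" where
  "strict_lists q k = {xs. length xs = q \<and> sorted_wrt (<) xs \<and> int (sum_list xs) = k}"

lemma finite_strict_lists: "finite (strict_lists q k)"
proof (rule finite_subset)
  show "strict_lists q k \<subseteq> {xs. set xs \<subseteq> {..nat k} \<and> length xs = q}"
    using member_le_sum_list by (fastforce simp: strict_lists_def)
qed (simp add: finite_lists_length_eq)

lemma strict_nth_ge:
  fixes xs :: "nat list"
  assumes "sorted_wrt (<) xs" "j < length xs"
  shows "j \<le> xs ! j"
  using assms(2)
proof (induction j)
  case (Suc j)
  have "xs ! j < xs ! Suc j"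
    using assms(1) Suc.prems by (simp add: sorted_wrt_iff_nth_less)
  with Suc show ?case by simp
qed simp

lemma strict_sum_ge:
  fixes xs :: "nat list"
  assumes "sorted_wrt (<) xs"
  shows "(\<Sum>j<length xs. j) \<le> sum_list xs"
  unfolding sum_list_sum_nth atLeast0LessThan
  by (rule sum_mono) (use strict_nth_ge[OF assms] in auto)

lemma sum_lessThan_int: "2 * (\<Sum>j<q. int j) = int q * (int q - 1)"
  by (induction q) (simp_all add: algebra_simps)

text \<open>Replacing the entry \<open>x\<close> at position \<open>j\<close> by
  \<open>x + 1 - j\<close> turns strict increase into weak increase with parts at least
  \<open>1\<close>. The shifts add up to \<open>- (q - 3) q / 2\<close>.\<close>

lemma card_strict_lists:
  "card (strict_lists q k) = num_partitions q (k - (int q - 3) * int q div 2)"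
proof -
  define N where "N = k - (int q - 3) * int q div 2"
  \<comment> \<open>One of \<open>q - 3\<close> and \<open>q\<close> is even, so \<open>div\<close>
    is exact here.\<close>
  have "2 * ((int q - 3) * int q div 2) = (int q - 3) * int q"
    by (rule dvd_mult_div_cancel) simp
  then have N: "(\<Sum>j<q. 1 - int j) = N - k"
    using sum_lessThan_int[of q] by (simp add: N_def sum_subtractf algebra_simps)
  define P where "P = {xs :: int list. length xs = q \<and> sorted xs \<and> (\<forall>x\<in>set xs. 1 \<le> x) \<and> sum_list xs = N}"
  define f where "f xs = map (\<lambda>j. int (xs ! j) + (1 - int j)) [0..<q]" for xs :: "nat list"
  define g where "g ys = map (\<lambda>j. nat (ys ! j + int j - 1)) [0..<q]" for ys :: "int list"
  have P1: "1 \<le> ys ! j" if "ys \<in> P" "j < q" for ys j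
    using that by (auto simp: P_def)
  have P2: "ys ! j \<le> ys ! Suc j" if "ys \<in> P" "Suc j < q" for ys j
    using that by (auto simp: P_def sorted_iff_nth_Suc)
  have S1: "xs ! j < xs ! Suc j" if "xs \<in> strict_lists q k" "Suc j < q" for xs j
    using that by (auto simp: strict_lists_def sorted_wrt_iff_nth_less)
  have "bij_betw f (strict_lists q k) P"
  proof (rule bij_betw_byWitness[of _ g])
    show "\<forall>xs\<in>strict_lists q k. g (f xs) = xs"
      by (auto simp: f_def g_def strict_lists_def intro!: nth_equalityI)
    show "\<forall>ys\<in>P. f (g ys) = ys"
    proof
      fix ys assume ys: "ys \<in> P"
      then have "length ys = q" by (simp add: P_def)
      then show "f (g ys) = ys"
        using P1[OF ys] by (force simp: f_def g_def intro!: nth_equalityI)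
    qed
    show "f ` strict_lists q k \<subseteq> P"
    proof (rule image_subsetI)
      fix xs assume xs: "xs \<in> strict_lists q k"
      then have "sum_list (f xs) = (\<Sum>j<q. int (xs ! j)) + (\<Sum>j<q. 1 - int j)"
        by (simp add: f_def interv_sum_list_conv_sum_set_nat sum.distrib sum_subtractf atLeast0LessThan)
      also have "(\<Sum>j<q. int (xs ! j)) = k"
        using xs by (auto simp: strict_lists_def sum_list_sum_nth atLeast0LessThan)
      finally have "sum_list (f xs) = N" using N by simp
      moreover have "sorted (f xs)"
        unfolding sorted_iff_nth_Suc using S1[OF xs] by (fastforce simp: f_def)
      moreover have "1 \<le> x" if "x \<in> set (f xs)" for x
        using that strict_nth_ge[of xs] xs by (auto simp: f_def strict_lists_def)
      ultimately show "f xs \<in> P" by (auto simp: P_def f_def)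
    qed
    show "g ` P \<subseteq> strict_lists q k"
    proof (rule image_subsetI)
      fix ys assume ys: "ys \<in> P"
      have "int (sum_list (g ys)) = (\<Sum>j<q. int (nat (ys ! j + int j - 1)))"
        by (simp add: g_def interv_sum_list_conv_sum_set_nat atLeast0LessThan)
      \<comment> \<open>Parts are at least \<open>1\<close>, so \<open>nat\<close> does not
        truncate.\<close>
      also have "\<dots> = (\<Sum>j<q. ys ! j - (1 - int j))"
        by (rule sum.cong) (use P1[OF ys] in force)+
      also have "\<dots> = N - (\<Sum>j<q. 1 - int j)"
        using ys by (auto simp: sum_subtractf P_def sum_list_sum_nth atLeast0LessThan)
      also have "\<dots> = k" using N by simp
      finally have "int (sum_list (g ys)) = k" .
      moreover have "sorted_wrt (<) (g ys)"
        using P1[OF ys] P2[OF ys] by (fastforce simp: sorted_wrt_iff_nth_Suc_transp g_def)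
      ultimately show "g ys \<in> strict_lists q k" by (simp add: strict_lists_def g_def)
    qed
  qed
  then show ?thesis
    unfolding num_partitions_def P_def N_def by (rule bij_betw_same_card)
qed

lemma sorted_wrt_snoc:
  "sorted_wrt (<) (xs @ [m]) \<longleftrightarrow> sorted_wrt (<) xs \<and> (\<forall>x\<in>set xs. x < (m :: nat))"
  by (auto simp: sorted_wrt_append)

text \<open>The dichotomy concerns the two largest entries. If they are not consecutive, all other
  entries, being smaller still, are at distance at least two from the largest as well.\<close>

lemma strict_list_cases:
  assumes "sorted_wrt (<) ys" "length ys = q" "2 \<le> q"
  obtains (consecutive) js i where "(js, i) \<in> omega_index q" "ys = js @ [i, Suc i]"
  | (gap) xs m where "ys = xs @ [m]" "sorted_wrt (<) xs" "\<And>x. x \<in> set xs \<Longrightarrow> Suc x < m"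
proof -
  obtain xs m where ys: "ys = xs @ [m]" using assms by (cases ys rule: rev_cases) auto
  with assms obtain js i where xs: "xs = js @ [i]" by (cases xs rule: rev_cases) auto
  have s: "sorted_wrt (<) xs" "\<forall>x\<in>set xs. x < m"
    using assms(1) by (auto simp: ys sorted_wrt_snoc)
  show thesis
  proof (cases "m = Suc i")
    case True
    show ?thesis
      by (rule consecutive[of js i]) (use assms ys xs s True in \<open>auto simp: omega_index_def\<close>)
  next
    case False
    show ?thesis
      by (rule gap[OF ys s(1)])
        (use False s in \<open>force simp: xs sorted_wrt_snoc\<close>)
  qed
qed

text \<open>Appending \<open>i + 1\<close> identifies \<open>B k\<close> with the strict lists of
  sum \<open>k\<close> whose two largest entries are consecutive. The remaining ones arise exactly
  once from the lists of sum \<open>k - 1\<close> by raising the last entry.\<close>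

lemma card_omega_index:
  assumes "2 \<le> q"
  defines "B k \<equiv> {J \<in> omega_index q. int (omega_degree J) = k}"
  shows "int (card (B k)) = int (card (strict_lists q k)) - int (card (strict_lists q (k - 1)))"
proof -
  define f where "f = (\<lambda>(js, i :: nat). js @ [i, Suc i])"
  define g where "g xs = butlast xs @ [Suc (last xs)]" for xs :: "nat list"
  have inj_f: "inj_on f (B k)" by (auto simp: inj_on_def f_def)
  have inj_g: "inj_on g (strict_lists q (k - 1))"
  proof (rule inj_onI)
    fix xs ys assume *: "xs \<in> strict_lists q (k - 1)" "ys \<in> strict_lists q (k - 1)" "g xs = g ys"
    have "xs \<noteq> []" "ys \<noteq> []" using * assms by (auto simp: strict_lists_def)
    moreover have "butlast xs = butlast ys" "last xs = last ys" using * by (auto simp: g_def)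
    ultimately show "xs = ys" by (metis append_butlast_last_id)
  qed
  have f: "f ` B k \<subseteq> strict_lists q k"
    using assms by (auto simp: B_def f_def strict_lists_def omega_index_def omega_degree_def sorted_wrt_append less_SucI)
  have "finite (f ` B k)" using f finite_strict_lists finite_subset by blast
  then have fin: "finite (B k)" using inj_f finite_imageD by blast
  have "strict_lists q k = f ` B k \<union> g ` strict_lists q (k - 1)"
  proof (intro equalityI subsetI)
    fix ys assume ys: "ys \<in> strict_lists q k"
    then have "sorted_wrt (<) ys" "length ys = q" by (auto simp: strict_lists_def)
    then show "ys \<in> f ` B k \<union> g ` strict_lists q (k - 1)"
      using assms(1)
    proof (cases rule: strict_list_cases)
      case (consecutive js i)
      then have "(js, i) \<in> B k" "ys = f (js, i)"
        using ys by (auto simp: B_def f_def strict_lists_def omega_degree_def)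
      then show ?thesis by blast
    next
      case (gap xs m)
      have "xs \<noteq> []" using gap ys assms by (auto simp: strict_lists_def)
      then have m: "0 < m" using gap(3)[of "hd xs"] by simp
      have "x < m - 1" if "x \<in> set xs" for x using gap(3)[OF that] by simp
      then have "xs @ [m - 1] \<in> strict_lists q (k - 1)"
        using gap ys m by (auto simp: strict_lists_def sorted_wrt_snoc of_nat_diff)
      moreover have "ys = g (xs @ [m - 1])" using gap m by (simp add: g_def)
      ultimately show ?thesis by blast
    qed
  next
    fix ys assume "ys \<in> f ` B k \<union> g ` strict_lists q (k - 1)"
    then show "ys \<in> strict_lists q k"
    proof
      assume "ys \<in> g ` strict_lists q (k - 1)"
      then obtain xs where xs: "xs \<in> strict_lists q (k - 1)" "ys = g xs" by blast
      then obtain zs m where "xs = zs @ [m]"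
        using assms by (cases xs rule: rev_cases) (auto simp: strict_lists_def)
      with xs show ?thesis
        by (auto simp: strict_lists_def g_def sorted_wrt_snoc less_SucI)
    qed (use f in blast)
  qed
  moreover have "f ` B k \<inter> g ` strict_lists q (k - 1) = {}"
  proof (rule ccontr)
    assume "f ` B k \<inter> g ` strict_lists q (k - 1) \<noteq> {}"
    then obtain js i xs where *: "js @ [i, Suc i] = g xs" "xs \<in> strict_lists q (k - 1)"
      by (auto simp: f_def)
    then have "xs \<noteq> []" using assms by (auto simp: strict_lists_def)
    then obtain zs m where xs: "xs = zs @ [m]" by (cases xs rule: rev_cases) auto
    \<comment> \<open>The original list would end in \<open>i, i\<close>, which is not strictly
      increasing.\<close>
    have "zs = js @ [i]" "i = m" using *(1) by (auto simp: xs g_def)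
    with *(2) show False by (auto simp: xs strict_lists_def sorted_wrt_append)
  qed
  ultimately have "card (strict_lists q k) = card (f ` B k) + card (g ` strict_lists q (k - 1))"
    using fin finite_strict_lists by (simp add: card_Un_disjoint)
  then show "int (card (B k)) = int (card (strict_lists q k)) - int (card (strict_lists q (k - 1)))"
    by (simp add: card_image[OF inj_f] card_image[OF inj_g])
qed

section \<open>Words in the basis of the Verma module\<close>

locale irreducible_verma =
  fixes lam :: "'k::field_char_0"
  assumes lam: "lam \<notin> \<nat>"
begin

abbreviation "ft \<equiv> verma_ft lam"
abbreviation "wedge_ft w \<equiv> wedge (map ft w)"
abbreviation "ext_X \<equiv> ext_deriv (verma_X lam)"

text \<open>A factor vanishes only for \<open>lam = l - 1\<close>, a natural number; hence the
  normalization of \<open>ft\<close> is invertible.\<close>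

lemma prod_ne_0: "(\<Prod>l = 1..i. lam - of_nat l + 1) \<noteq> 0"
proof (subst prod_zero_iff, safe)
  fix l assume "l \<in> {1..i}" "lam - of_nat l + 1 = 0"
  then have "lam = of_nat (l - 1)" by (simp add: of_nat_diff algebra_simps)
  with lam show False by simp
qed

lemma ext_vec_ft:
  "ext_vec (ft a) = ext_scale (1 / (\<Prod>l = 1..a. lam - of_nat l + 1)) (ext_vec (verma_f a))"
  by (simp only: verma_ft_def ext_vec_linear)

lemma ext_vec_basis:
  shows "ext_vec (verma_f a) = ext_scale (\<Prod>l = 1..a. lam - of_nat l + 1) (ext_vec (ft a))"
  using prod_ne_0[of a] by (simp only: ext_vec_ft ext.scale_scale) simp

lemma verma_X_ft_0: "verma_X lam (ft 0) = 0"
  by (simp add: verma_ft_def verma_X_def del: single_one)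

lemma verma_X_ft_Suc:
  shows "verma_X lam (ft (Suc i)) = ft i"
proof -
  have "lam - of_nat i \<noteq> 0" using lam by auto
  then show ?thesis
    by (simp add: verma_ft_def verma_X_def)
qed

lemma verma_H_ft: "verma_H lam (ft i) = pm_scale (lam - 2 * of_nat i) (ft i)"
  by (simp add: verma_ft_def verma_H_def mult.commute)

text \<open>Later only the shift of the index matters, so the scalar is left unspecified.\<close>

lemma verma_Y_ft:
  obtains c where "verma_Y (ft i) = pm_scale c (ft (Suc i))"
proof (rule that)
  have "lam - of_nat i \<noteq> 0" using lam by auto
  then show "verma_Y (ft i) = pm_scale ((of_nat i + 1) * (lam - of_nat i)) (ft (Suc i))"
    by (simp add: verma_ft_def verma_Y_def)
qed

text \<open>Words are unsorted and may repeat letters, which suits the Leibniz rule. The degree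
  \<open>d\<close> governs weights and the nilpotency of \<open>X\<close>; the strict bound
  \<open>m\<close> on the letters serves to recognize gaps.\<close>

definition word_space :: "nat \<Rightarrow> nat \<Rightarrow> nat \<Rightarrow> (nat, 'k) exterior_algebra set" where
  "word_space q d m = ext.span (wedge_ft ` {w. length w = q \<and> sum_list w = d \<and> (\<forall>x\<in>set w. x < m)})"

lemma subspace_word_space: "ext.subspace (word_space q d m)"
  by (simp add: word_space_def)

lemma word_in_word_space:
  "length w = q \<Longrightarrow> sum_list w = d \<Longrightarrow> (\<And>x. x \<in> set w \<Longrightarrow> x < m) \<Longrightarrow> wedge_ft w \<in> word_space q d m"
  unfolding word_space_def by (rule ext.span_base) auto

lemma word_space_induct:
  fixes f :: "(nat, 'k) exterior_algebra \<Rightarrow> (nat, 'k) exterior_algebra"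
  assumes "Vector_Spaces.linear ext_scale ext_scale f" "x \<in> word_space q d m" "ext.subspace S"
    and "\<And>w. length w = q \<Longrightarrow> sum_list w = d \<Longrightarrow> (\<And>x. x \<in> set w \<Longrightarrow> x < m) \<Longrightarrow> f (wedge_ft w) \<in> S"
  shows "f x \<in> S"
  by (rule ext.linear_image_span_subset[OF assms(1) assms(2)[unfolded word_space_def] assms(3)])
    (use assms(4) in auto)

lemma word_space_subset_ext_power: "word_space q d m \<subseteq> ext_power q"
  unfolding word_space_def
  by (rule ext.span_minimal) (auto simp: wedge_in_ext_power, simp add: ext_power_def)

lemma word_space_Cons:
  assumes "x \<in> word_space q d m" "a < m"
  shows "ext_vec (ft a) * x \<in> word_space (Suc q) (a + d) m"
proof (rule word_space_induct[OF linear_ext_mult(1) assms(1) subspace_word_space])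
  fix w assume w: "length w = q" "sum_list w = d" "\<And>x. x \<in> set w \<Longrightarrow> x < m"
  have "wedge_ft (a # w) \<in> word_space (Suc q) (a + d) m"
    by (rule word_in_word_space) (use w assms(2) in auto)
  then show "ext_vec (ft a) * wedge_ft w \<in> word_space (Suc q) (a + d) m"
    by (simp add: wedge_simps)
qed

lemma word_space_snoc:
  assumes "x \<in> word_space q d m" "m \<le> m'" "a < m'"
  shows "x * ext_vec (ft a) \<in> word_space (Suc q) (d + a) m'"
proof (rule word_space_induct[OF linear_ext_mult(2) assms(1) subspace_word_space])
  fix w assume w: "length w = q" "sum_list w = d" "\<And>x. x \<in> set w \<Longrightarrow> x < m"
  have "wedge_ft (w @ [a]) \<in> word_space (Suc q) (d + a) m'"
    by (rule word_in_word_space) (use w assms(2,3) in force)+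
  then show "wedge_ft w * ext_vec (ft a) \<in> word_space (Suc q) (d + a) m'"
    by (simp add: wedge_simps)
qed

section \<open>Action of \<open>H\<close>, \<open>Y\<close> and \<open>X\<close> on words\<close>

lemma ext_H_word: "ext_deriv (verma_H lam) (wedge_ft w) =
    ext_scale (of_nat (length w) * lam - 2 * of_nat (sum_list w)) (wedge_ft w)"
proof (induction w)
  case Nil
  then show ?case by (simp add: wedge_simps ext_deriv_one)
next
  case (Cons a w)
  have "of_nat (length (a # w)) * lam - 2 * of_nat (sum_list (a # w)) =
      (lam - 2 * of_nat a) + (of_nat (length w) * lam - 2 * of_nat (sum_list w))"
    by (simp add: algebra_simps)
  with Cons show ?case
    by (simp only: ext.scale_left_distrib list.map wedge_simps ext_deriv_mult
        ext_deriv_vec[OF linear_verma(3)] verma_H_ft ext_vec_linear ext_scale_mult_left ext_scale_mult_right)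
qed

lemma ext_H_word_space:
  assumes "x \<in> word_space q d m"
  shows "ext_deriv (verma_H lam) x = ext_scale (of_nat q * lam - 2 * of_nat d) x"
proof -
  define c where "c = of_nat q * lam - 2 * of_nat d"
  have "ext_deriv (verma_H lam) x - ext_scale c x \<in> {0}"
  proof (rule word_space_induct[OF _ assms])
    show "Vector_Spaces.linear ext_scale ext_scale (\<lambda>x. ext_deriv (verma_H lam) x - ext_scale c x)"
      by unfold_locales
        (simp_all add: ext_deriv_linear_simps ext.scale_right_distrib ext.scale_right_diff_distrib
          mult.commute)
  qed (auto simp: ext_H_word c_def ext.subspace_def)
  then show ?thesis by (simp add: c_def)
qed

lemma ext_Y_word:
  assumes "\<And>x. x \<in> set w \<Longrightarrow> x < m"
  shows "ext_deriv verma_Y (wedge_ft w) \<in> word_space (length w) (Suc (sum_list w)) (Suc m)"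
  using assms
proof (induction w)
  case Nil
  then show ?case by (simp add: wedge_simps ext_deriv_one ext.subspace_0 subspace_word_space)
next
  case (Cons a w)
  obtain c where c: "verma_Y (ft a) = pm_scale c (ft (Suc a))" using verma_Y_ft .
  have "ext_scale c (wedge_ft (Suc a # w)) \<in> word_space (length (a # w)) (Suc (sum_list (a # w))) (Suc m)"
    by (intro ext.subspace_scale subspace_word_space word_in_word_space) (use Cons.prems in \<open>auto intro: less_SucI\<close>)
  moreover have "ext_vec (ft a) * ext_deriv verma_Y (wedge_ft w) \<in>
      word_space (length (a # w)) (Suc (sum_list (a # w))) (Suc m)"
    using word_space_Cons[OF Cons.IH, of a] Cons.prems by (simp add: less_SucI)
  ultimately show ?case
    by (simp add: wedge_simps ext_deriv_mult ext_deriv_vec linear_verma c ext_vec_linear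
        ext_scale_mult_left ext.subspace_add subspace_word_space)
qed

lemma ext_Y_word_space:
  assumes "x \<in> word_space q d m"
  shows "ext_deriv verma_Y x \<in> word_space q (Suc d) (Suc m)"
  by (rule word_space_induct[OF linear_ext_deriv assms subspace_word_space])
    (use ext_Y_word in blast)

lemma ext_Y_pow_word_space:
  assumes "x \<in> word_space q d m"
  shows "(ext_deriv verma_Y ^^ n) x \<in> word_space q (d + n) (m + n)"
  using assms by (induction n) (auto intro: ext_Y_word_space)

text \<open>By the Leibniz rule one letter is lowered at a time, and a letter \<open>0\<close>
  contributes nothing. Writing the degree condition with \<open>Suc\<close> leaves no words at all
  when the sum is \<open>0\<close>, so the span is then zero.\<close>

lemma ext_X_word:
  assumes "\<And>x. x \<in> set w \<Longrightarrow> x < m"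
  shows "ext_X (wedge_ft w) \<in> ext.span (wedge_ft ` {w'. length w' = length w \<and> Suc (sum_list w') = sum_list w
    \<and> (\<forall>x\<in>set w'. x < m)})" (is "_ \<in> ext.span (wedge_ft ` ?W w)")
  using assms
proof (induction w)
  case Nil
  then show ?case by (simp add: wedge_simps ext_deriv_one ext.span_zero)
next
  case (Cons a w)
  have "ext_vec (verma_X lam (ft a)) * wedge_ft w \<in> ext.span (wedge_ft ` ?W (a # w))"
  proof (cases a)
    case 0
    then show ?thesis by (simp add: verma_X_ft_0 ext_vec_linear ext.span_zero)
  next
    case (Suc b)
    have "b # w \<in> ?W (a # w)" using Cons.prems Suc by (auto intro: Suc_lessD)
    then have "wedge_ft (b # w) \<in> ext.span (wedge_ft ` ?W (a # w))" by (intro ext.span_base imageI)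
    then show ?thesis by (simp add: verma_X_ft_Suc Suc wedge_simps)
  qed
  moreover have "ext_vec (ft a) * ext_X (wedge_ft w) \<in> ext.span (wedge_ft ` ?W (a # w))"
  proof (rule ext.linear_image_span_subset[OF linear_ext_mult(1)])
    show "ext_X (wedge_ft w) \<in> ext.span (wedge_ft ` ?W w)" using Cons by simp
    fix b assume "b \<in> wedge_ft ` ?W w"
    then obtain w' where w': "w' \<in> ?W w" "b = wedge_ft w'" by blast
    have "a # w' \<in> ?W (a # w)" using Cons.prems w' by auto
    then have "wedge_ft (a # w') \<in> ext.span (wedge_ft ` ?W (a # w))" by (intro ext.span_base imageI)
    then show "ext_vec (ft a) * b \<in> ext.span (wedge_ft ` ?W (a # w))" by (simp add: w' wedge_simps)
  qed simp
  ultimately show ?case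
    by (simp add: wedge_simps ext_deriv_mult ext_deriv_vec linear_verma ext.span_add)
qed

lemma ext_X_word_space_0:
  assumes "x \<in> word_space q 0 m"
  shows "ext_X x = 0"
proof -
  have "ext_X x \<in> {0}"
  proof (rule word_space_induct[OF linear_ext_deriv assms])
    fix w assume w: "sum_list w = 0" "\<And>x. x \<in> set w \<Longrightarrow> x < m"
    show "ext_X (wedge_ft w) \<in> {0}"
      using ext_X_word[of w m] w by simp
  qed (simp add: ext.subspace_def)
  then show ?thesis by simp
qed

lemma ext_X_word_space_Suc:
  assumes "x \<in> word_space q (Suc d) m"
  shows "ext_X x \<in> word_space q d m"
proof (rule word_space_induct[OF linear_ext_deriv assms subspace_word_space])
  fix w assume w: "length w = q" "sum_list w = Suc d" "\<And>x. x \<in> set w \<Longrightarrow> x < m"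
  show "ext_X (wedge_ft w) \<in> word_space q d m"
    using ext_X_word[of w m] w by (simp add: word_space_def)
qed

lemma ext_X_pow_word_space:
  assumes "x \<in> word_space q d m" "l \<le> d"
  shows "(ext_X ^^ l) x \<in> word_space q (d - l) m"
  using assms(2)
proof (induction l)
  case (Suc l)
  then have "(ext_X ^^ l) x \<in> word_space q (Suc (d - Suc l)) m" by (simp add: Suc_diff_Suc)
  then show ?case using ext_X_word_space_Suc by simp
qed (use assms in simp)

text \<open>Each \<open>X\<close> lowers the degree by one, and there is nothing below degree
  \<open>0\<close>.\<close>

lemma ext_X_pow_word_space_0:
  assumes "x \<in> word_space q d m" "d < l"
  shows "(ext_X ^^ l) x = 0"
proof -
  have "ext_X ((ext_X ^^ d) x) = 0"
    using ext_X_pow_word_space[OF assms(1), of d] by (intro ext_X_word_space_0) simp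
  then have "(ext_X ^^ ((l - Suc d) + Suc d)) x = 0"
    by (simp only: funpow_add o_apply funpow.simps(2) ext_verma.X_pow_0)
  with assms(2) show ?thesis by simp
qed

section \<open>Coordinates and sorting of words\<close>

text \<open>Each letter acts by \<open>grassmann_mult\<close> up to a nonzero factor. A repeated
  letter gives coefficient \<open>0\<close>, so the same formula covers words that are not
  injective.\<close>

lemma ext_coords_word:
  obtains c where "ext_coords (wedge_ft w) = Poly_Mapping.single (set w) c"
    "sorted_wrt (<) w \<Longrightarrow> c \<noteq> 0"
proof -
  have "\<exists>c. ext_coords (wedge_ft w) = Poly_Mapping.single (set w) c \<and> (sorted_wrt (<) w \<longrightarrow> c \<noteq> 0)"
  proof (induction w)
    case Nil
    then show ?case by (auto simp: wedge_simps ext_coords_one)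
  next
    case (Cons a w)
    then obtain c where c: "ext_coords (wedge_ft w) = Poly_Mapping.single (set w) c"
      "sorted_wrt (<) w \<longrightarrow> c \<noteq> 0" by blast
    define k where "k = 1 / (\<Prod>l = 1..a. lam - of_nat l + 1)"
    have k: "k \<noteq> 0" using prod_ne_0 by (simp add: k_def)
    have "ext_coords (wedge_ft (a # w)) = pm_scale k (grassmann_mult a (Poly_Mapping.single (set w) c))"
      by (simp only: list.map wedge_simps ext_vec_ft k_def ext_scale_mult_left
          ext_coords_linear ext_coords_basis_mult c(1))
    then have "ext_coords (wedge_ft (a # w)) = Poly_Mapping.single (set (a # w))
        (if a \<in> set w then 0 else k * (c * (- 1) ^ card {s \<in> set w. s < a}))"
      by (simp add: grassmann_mult_single)
    then show ?case
      by (intro exI conjI) (use k c(2) in auto)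
  qed
  then show thesis using that by blast
qed

lemma lookup_ext_coords_word:
  assumes "S \<noteq> set w"
  shows "Poly_Mapping.lookup (ext_coords (wedge_ft w)) S = 0"
  using ext_coords_word[of w] assms by (metis lookup_single_not_eq)

lemma lookup_ext_coords_word_self:
  assumes "sorted_wrt (<) w"
  shows "Poly_Mapping.lookup (ext_coords (wedge_ft w)) (set w) \<noteq> 0"
  using ext_coords_word[of w] assms by (metis lookup_single_eq)

lemma lookup_ext_coords_span:
  assumes "x \<in> ext.span (wedge_ft ` W)" "S \<notin> set ` W"
  shows "Poly_Mapping.lookup (ext_coords x) S = 0"
proof -
  interpret c: Vector_Spaces.linear ext_scale "(*)" "\<lambda>v. Poly_Mapping.lookup (ext_coords v) S"
    by (rule linear_ext_coord)
  show ?thesis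
    using assms(1)
  proof (induction rule: ext.span_induct_alt)
    case base
    show ?case by (rule c.zero)
  next
    case (step k x y)
    then obtain w where "w \<in> W" "x = wedge_ft w" by auto
    then have "Poly_Mapping.lookup (ext_coords x) S = 0"
      using assms(2) lookup_ext_coords_word[of S w] by auto
    with step show ?case by (simp only: c.add c.scale) simp
  qed
qed

text \<open>One step of insertion sort: \<open>a\<close> moves right past the smaller letters, each
  exchange changing the sign.\<close>

lemma wedge_ft_insert:
  assumes "sorted_wrt (<) xs" "a \<notin> set xs"
  obtains ys where "sorted_wrt (<) ys" "set ys = insert a (set xs)" "length ys = Suc (length xs)"
    "ext_vec (ft a) * wedge_ft xs = wedge_ft ys \<or> ext_vec (ft a) * wedge_ft xs = - wedge_ft ys"
proof -
  have "\<exists>ys. sorted_wrt (<) ys \<and> set ys = insert a (set xs) \<and> length ys = Suc (length xs) \<and>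
    (ext_vec (ft a) * wedge_ft xs = wedge_ft ys \<or> ext_vec (ft a) * wedge_ft xs = - wedge_ft ys)"
    using assms
  proof (induction xs)
    case Nil
    then show ?case by (intro exI[of _ "[a]"]) (simp add: wedge_simps)
  next
    case (Cons x xs)
    show ?case
    proof (cases "a < x")
      case True
      then show ?thesis
        using Cons.prems by (intro exI[of _ "a # x # xs"]) (auto simp: wedge_simps)
    next
      case False
      from Cons obtain ys where ys: "sorted_wrt (<) ys" "set ys = insert a (set xs)"
        "length ys = Suc (length xs)"
        "ext_vec (ft a) * wedge_ft xs = wedge_ft ys \<or> ext_vec (ft a) * wedge_ft xs = - wedge_ft ys" by auto
      have "ext_vec (ft a) * wedge_ft (x # xs) = - (ext_vec (ft x) * (ext_vec (ft a) * wedge_ft xs))"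
        using ext_vec_anticommute[of "ft a" "ft x"]
        by (simp add: wedge_simps flip: mult.assoc)
      then show ?thesis
        using ys False Cons.prems
        by (intro exI[of _ "x # ys"]) (auto simp: wedge_simps)
    qed
  qed
  then show thesis using that by blast
qed

text \<open>Anticommutation moves \<open>a\<close> next to its other occurrence, where the square of
  a vector appears.\<close>

lemma ext_vec_mult_wedge_ft_mem:
  assumes "a \<in> set xs"
  shows "ext_vec (ft a) * wedge_ft xs = 0"
  using assms
proof (induction xs)
  case (Cons x xs)
  show ?case
  proof (cases "a = x")
    case True
    then show ?thesis by (simp add: wedge_simps ext_vec_square flip: mult.assoc)
  next
    case False
    have "ext_vec (ft a) * wedge_ft (x # xs) = - (ext_vec (ft x) * (ext_vec (ft a) * wedge_ft xs))"
      using ext_vec_anticommute[of "ft a" "ft x"]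
      by (simp add: wedge_simps flip: mult.assoc)
    with False Cons show ?thesis by simp
  qed
qed simp

lemma wedge_ft_sort:
  "wedge_ft w = 0 \<or> (\<exists>xs. sorted_wrt (<) xs \<and> set xs = set w \<and> length xs = length w \<and>
     (wedge_ft w = wedge_ft xs \<or> wedge_ft w = - wedge_ft xs))"
proof (induction w)
  case (Cons a w)
  show ?case
  proof (cases "a \<in> set w \<or> wedge_ft w = 0")
    case True
    then show ?thesis using ext_vec_mult_wedge_ft_mem[of a w] by (auto simp: wedge_simps)
  next
    case False
    with Cons obtain xs where xs: "sorted_wrt (<) xs" "set xs = set w" "length xs = length w"
      "wedge_ft w = wedge_ft xs \<or> wedge_ft w = - wedge_ft xs" by auto
    from wedge_ft_insert[OF xs(1), of a] False xs(2)
    obtain ys where ys: "sorted_wrt (<) ys" "set ys = insert a (set xs)" "length ys = Suc (length xs)"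
      "ext_vec (ft a) * wedge_ft xs = wedge_ft ys \<or> ext_vec (ft a) * wedge_ft xs = - wedge_ft ys" by auto
    show ?thesis
      by (rule disjI2, rule exI[of _ ys]) (use xs ys in \<open>auto simp: wedge_simps\<close>)
  qed
qed (rule disjI2, rule exI[of _ "[]"], simp)

text \<open>Each factor is expanded in the basis \<open>verma_f\<close>, whose vectors are multiples
  of the vectors \<open>ft\<close>.\<close>

lemma ext_power_eq_span_words:
  shows "ext_power q = ext.span (wedge_ft ` {w. length w = q})"
proof
  have "wedge vs \<in> ext.span (wedge_ft ` {w. length w = length vs})" for vs
  proof (induction vs)
    case Nil
    have "wedge_ft [] \<in> ext.span (wedge_ft ` {w. length w = 0})" by (intro ext.span_base imageI) simp
    then show ?case by simp
  next
    case (Cons v vs)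
    let ?S = "ext.span (wedge_ft ` {w. length w = Suc (length vs)})"
    have *: "ext_vec (ft a) * wedge vs \<in> ?S" for a
    proof (rule ext.linear_image_span_subset[OF linear_ext_mult(1) Cons])
      fix b assume "b \<in> wedge_ft ` {w. length w = length vs}"
      then obtain w where w: "length w = length vs" "b = wedge_ft w" by auto
      have "wedge_ft (a # w) \<in> ?S" by (intro ext.span_base imageI) (simp add: w)
      then show "ext_vec (ft a) * b \<in> ?S" by (simp add: w wedge_simps)
    qed simp
    have "ext_vec (verma_f a) * wedge vs \<in> ?S" for a
      using * by (simp add: ext_vec_basis ext_scale_mult_left ext.span_scale)
    then have "ext_vec v * wedge vs \<in> ?S"
      by (induction v rule: pm_induct)
        (simp_all add: ext_vec_linear distrib_right ext_scale_mult_left ext.span_zero ext.span_add ext.span_scale)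
    then show ?case by (simp add: wedge_simps)
  qed
  then show "ext_power q \<subseteq> ext.span (wedge_ft ` {w. length w = q})"
    unfolding ext_power_def by (intro ext.span_minimal) auto
  show "ext.span (wedge_ft ` {w. length w = q}) \<subseteq> ext_power q"
    by (rule ext.span_minimal) (auto simp: wedge_in_ext_power, simp add: ext_power_def)
qed

lemma ext_power_eq_span_sorted:
  shows "ext_power q = ext.span (wedge_ft ` {w. length w = q \<and> sorted_wrt (<) w})" (is "_ = ?S")
proof
  show "ext_power q \<subseteq> ?S"
    unfolding ext_power_eq_span_words
  proof (rule ext.span_minimal, clarify)
    fix w :: "nat list" assume "q = length w"
    have *: "wedge_ft xs \<in> ext.span (wedge_ft ` {w'. length w' = length w \<and> sorted_wrt (<) w'})"
      if "sorted_wrt (<) xs" "length xs = length w" for xs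
      by (rule ext.span_base, rule imageI) (use that in auto)
    then show "wedge_ft w \<in> ext.span (wedge_ft ` {w'. length w' = length w \<and> sorted_wrt (<) w'})"
      using wedge_ft_sort[of w] by (auto simp: ext.span_zero ext.span_neg)
  qed simp
  show "?S \<subseteq> ext_power q"
    unfolding ext_power_eq_span_words by (intro ext.span_mono) auto
qed

section \<open>The vectors \<open>omega\<close> and the gap space\<close>

text \<open>A word of degree \<open>s\<close> is killed by \<open>X ^^ l\<close> for
  \<open>l > s\<close>, which makes the sum finite.\<close>

lemma omega_eq_sum:
  assumes "wedge_ft (js @ [i]) \<in> word_space r s m"
  shows "omega lam (js, i) =
    (\<Sum>l<Suc s. (- 1) ^ l * ((ext_X ^^ l) (wedge_ft (js @ [i])) * ext_vec (ft (i + 1 + l))))"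
  unfolding omega_def prod.case
  by (rule Sum_any.expand_superset)
    (use ext_X_pow_word_space_0[OF assms] in \<open>auto simp: less_Suc_eq_le not_le intro: ccontr\<close>)

text \<open>
  For \<open>q \<ge> 2\<close> the gap space turns out to be a complement of the kernel of \<open>X\<close> in the exterior power.
\<close>

definition gap_lists :: "nat \<Rightarrow> nat list set" where
  "gap_lists q = {xs @ [m] | xs m. Suc (length xs) = q \<and> sorted_wrt (<) xs \<and> (\<forall>x\<in>set xs. Suc x < m)}"

definition gap_space :: "nat \<Rightarrow> (nat, 'k) exterior_algebra set" where
  "gap_space q = ext.span (wedge_ft ` gap_lists q)"

lemma subspace_gap_space: "ext.subspace (gap_space q)"
  by (simp add: gap_space_def)

text \<open>Letters below \<open>m < n\<close> are at most \<open>n - 2\<close>, so sorting them and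
  appending \<open>n\<close> gives a gap list.\<close>

lemma word_space_mult_gap:
  assumes "x \<in> word_space r d m" "m < n"
  shows "x * ext_vec (ft n) \<in> gap_space (Suc r)"
proof (rule word_space_induct[OF linear_ext_mult(2) assms(1) subspace_gap_space])
  fix w assume w: "length w = r" "\<And>x. x \<in> set w \<Longrightarrow> x < m"
  have *: "wedge_ft xs * ext_vec (ft n) \<in> gap_space (Suc r)"
    if "sorted_wrt (<) xs" "set xs = set w" "length xs = length w" for xs
  proof -
    have "Suc x < n" if "x \<in> set xs" for x using that w assms(2) \<open>set xs = set w\<close> by fastforce
    then have "xs @ [n] \<in> gap_lists (Suc r)" using that w by (auto simp: gap_lists_def)
    then have "wedge_ft (xs @ [n]) \<in> gap_space (Suc r)"
      unfolding gap_space_def by (intro ext.span_base imageI)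
    then show ?thesis by (simp add: wedge_simps)
  qed
  show "wedge_ft w * ext_vec (ft n) \<in> gap_space (Suc r)"
    using wedge_ft_sort[of w] * ext.subspace_neg[OF subspace_gap_space]
    by (auto simp: ext.subspace_0[OF subspace_gap_space])
qed

lemma wedge_ft_in_word_space:
  assumes "sorted_wrt (<) (js @ [i])"
  shows "wedge_ft (js @ [i]) \<in> word_space (Suc (length js)) (sum_list js + i) (Suc i)"
  by (rule word_in_word_space) (use assms in \<open>auto simp: sorted_wrt_snoc less_SucI\<close>)

text \<open>The term \<open>l = 0\<close> is the leading word. For \<open>l > 0\<close> the appended
  letter is at least \<open>i + 2\<close>, while \<open>X ^^ l\<close> leaves the other letters at
  most \<open>i\<close>.\<close>

lemma omega_minus_leading:
  assumes "sorted_wrt (<) (js @ [i])"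
  shows "omega lam (js, i) - wedge_ft (js @ [i, Suc i]) \<in> gap_space (length js + 2)"
proof -
  define u where "u = wedge_ft (js @ [i])"
  define s where "s = sum_list js + i"
  have u: "u \<in> word_space (Suc (length js)) s (Suc i)"
    using wedge_ft_in_word_space[OF assms] by (simp add: u_def s_def)
  have "omega lam (js, i) = u * ext_vec (ft (Suc i)) +
      (\<Sum>l<s. (- 1) ^ Suc l * ((ext_X ^^ Suc l) u * ext_vec (ft (i + 1 + Suc l))))"
    unfolding omega_eq_sum[OF u[unfolded u_def]] sum.lessThan_Suc_shift by (simp add: u_def)
  moreover have "u * ext_vec (ft (Suc i)) = wedge_ft (js @ [i, Suc i])"
    by (simp add: u_def wedge_simps mult.assoc)
  moreover have "(\<Sum>l<s. (- 1) ^ Suc l * ((ext_X ^^ Suc l) u * ext_vec (ft (i + 1 + Suc l))))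
      \<in> gap_space (length js + 2)"
  proof (intro ext.subspace_sum subspace_gap_space neg_one_power_mult_mem)
    fix l assume "l \<in> {..<s}"
    then have "(ext_X ^^ Suc l) u \<in> word_space (Suc (length js)) (s - Suc l) (Suc i)"
      by (intro ext_X_pow_word_space[OF u]) simp
    from word_space_mult_gap[OF this, of "i + 1 + Suc l"]
    show "(ext_X ^^ Suc l) u * ext_vec (ft (i + 1 + Suc l)) \<in> gap_space (length js + 2)" by simp
  qed
  ultimately show ?thesis by simp
qed

text \<open>What \<open>X ^^ l\<close> takes from the degree, the letter \<open>i + 1 + l\<close>
  restores. The last letter occurring, at \<open>l = s\<close>, determines the bound.\<close>

lemma omega_in_word_space:
  assumes "sorted_wrt (<) (js @ [i])"
  shows "omega lam (js, i) \<in>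
    word_space (length js + 2) (sum_list js + 2 * i + 1) (sum_list js + 2 * i + 2)"
proof -
  define u where "u = wedge_ft (js @ [i])"
  define s where "s = sum_list js + i"
  have u: "u \<in> word_space (Suc (length js)) s (Suc i)"
    using wedge_ft_in_word_space[OF assms] by (simp add: u_def s_def)
  show ?thesis
    unfolding omega_eq_sum[OF u[unfolded u_def]] u_def[symmetric]
  proof (intro ext.subspace_sum subspace_word_space neg_one_power_mult_mem)
    fix l assume l: "l \<in> {..<Suc s}"
    then have "(ext_X ^^ l) u \<in> word_space (Suc (length js)) (s - l) (Suc i)"
      by (intro ext_X_pow_word_space[OF u]) simp
    then have "(ext_X ^^ l) u * ext_vec (ft (i + 1 + l)) \<in>
        word_space (Suc (Suc (length js))) (s - l + (i + 1 + l)) (sum_list js + 2 * i + 2)"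
      by (rule word_space_snoc) (use l in \<open>auto simp: s_def\<close>)
    then show "(ext_X ^^ l) u * ext_vec (ft (i + 1 + l)) \<in>
        word_space (length js + 2) (sum_list js + 2 * i + 1) (sum_list js + 2 * i + 2)"
      using l by (simp add: s_def mult_2 add.assoc)
  qed
qed

text \<open>By the Leibniz rule the \<open>l\<close>-th term is mapped to
  \<open>t l - t (Suc l)\<close>, so the sum telescopes. At the ends, \<open>t 0\<close> contains
  \<open>ft i\<close> twice and \<open>t (Suc s)\<close> vanishes for degree reasons.\<close>

lemma ext_X_omega:
  assumes "sorted_wrt (<) (js @ [i])"
  shows "ext_X (omega lam (js, i)) = 0"
proof -
  define u where "u = wedge_ft (js @ [i])"
  define s where "s = sum_list js + i"
  have u: "u \<in> word_space (Suc (length js)) s (Suc i)"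
    using wedge_ft_in_word_space[OF assms] by (simp add: u_def s_def)
  define t where "t l = (- 1) ^ l * ((ext_X ^^ l) u * ext_vec (ft (i + l)))" for l
  have "ext_X (omega lam (js, i)) = (\<Sum>l<Suc s. t l - t (Suc l))"
    unfolding omega_eq_sum[OF u[unfolded u_def]] u_def[symmetric] ext_deriv_linear_simps
    by (rule sum.cong)
      (simp_all add: t_def ext_deriv_neg_one_power_mult ext_deriv_mult[of _ "(ext_X ^^ _) u"] ext_deriv_vec
        linear_verma verma_X_ft_Suc distrib_left)
  also have "\<dots> = t 0 - t (Suc s)" by (rule sum_lessThan_telescope')
  also have "t (Suc s) = 0" using ext_X_pow_word_space_0[OF u, of "Suc s"] by (simp add: t_def del: funpow.simps)
  also have "t 0 = 0" by (simp add: t_def u_def wedge_simps mult.assoc ext_vec_square)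
  finally show ?thesis by simp
qed

lemma lookup_ext_coords_gap:
  assumes "x \<in> gap_space q" "sorted_wrt (<) (js @ [i])"
  shows "Poly_Mapping.lookup (ext_coords x) (set (js @ [i, Suc i])) = 0"
proof (rule lookup_ext_coords_span[OF assms(1)[unfolded gap_space_def]], rule notI)
  assume "set (js @ [i, Suc i]) \<in> set ` gap_lists q"
  then obtain xs m where *: "set (js @ [i, Suc i]) = set (xs @ [m])" "\<And>x. x \<in> set xs \<Longrightarrow> Suc x < m"
    by (auto simp: gap_lists_def)
  have "i \<in> set (xs @ [m])" "Suc i \<in> set (xs @ [m])"
    unfolding *(1)[symmetric] by simp_all
  then have "Suc i < m \<or> i = m" "Suc (Suc i) < m \<or> Suc i = m"
    using *(2) by auto
  moreover have "m \<in> set (js @ [i, Suc i])" unfolding *(1) by simp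
  then have "m \<le> Suc i" using assms(2) by (auto simp: sorted_wrt_snoc)
  ultimately show False by linarith
qed

lemma strict_list_eqI:
  fixes xs ys :: "nat list"
  assumes "sorted_wrt (<) xs" "sorted_wrt (<) ys" "set xs = set ys"
  shows "xs = ys"
  using assms by (metis strict_sorted_equal)

text \<open>The coordinates at the leading sets form a dual family up to nonzero factors: gap terms
  do not contribute, and distinct indices have distinct leading sets.\<close>

lemma lin_indep_omega: "lin_indep_family ext_scale (omega lam) (omega_index q)"
proof (rule ext.lin_indep_family_dual)
  let ?c = "\<lambda>(js, i). \<lambda>v :: (nat, 'k) exterior_algebra.
    Poly_Mapping.lookup (ext_coords v) (set (js @ [i, Suc i]))"
  have strict: "sorted_wrt (<) (js @ [i, Suc i])" if "(js, i) \<in> omega_index q" for js i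
    using that by (auto simp: omega_index_def sorted_wrt_append less_SucI)
  have eq: "?c (js, i) (omega lam (js', i')) =
      Poly_Mapping.lookup (ext_coords (wedge_ft (js' @ [i', Suc i']))) (set (js @ [i, Suc i]))"
    if J: "(js, i) \<in> omega_index q" "(js', i') \<in> omega_index q" for js i js' i'
  proof -
    interpret c: Vector_Spaces.linear ext_scale "(*)"
      "\<lambda>v. Poly_Mapping.lookup (ext_coords v) (set (js @ [i, Suc i]))"
      by (rule linear_ext_coord)
    have "Poly_Mapping.lookup (ext_coords (omega lam (js', i') - wedge_ft (js' @ [i', Suc i'])))
        (set (js @ [i, Suc i])) = 0"
      by (rule lookup_ext_coords_gap[OF omega_minus_leading]) (use J in \<open>auto simp: omega_index_def\<close>)
    then show ?thesis by (simp only: c.diff prod.case right_minus_eq)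
  qed
  fix I assume I: "I \<in> omega_index q"
  then obtain js i where Ii: "I = (js, i)" by (cases I) auto
  show "Vector_Spaces.linear ext_scale (*) (?c I)"
    unfolding Ii prod.case by (rule linear_ext_coord)
  show "?c I (omega lam I) \<noteq> 0"
    using I unfolding Ii eq[OF I[unfolded Ii] I[unfolded Ii]]
    by (intro lookup_ext_coords_word_self strict)
  fix J assume J: "J \<in> omega_index q" "I \<noteq> J"
  obtain js' i' where Ji: "J = (js', i')" by (cases J) auto
  have "set (js @ [i, Suc i]) \<noteq> set (js' @ [i', Suc i'])"
    using strict_list_eqI[OF strict[of js i] strict[of js' i']] I J by (auto simp: Ii Ji)
  then show "?c I (omega lam J) = 0"
    unfolding Ii Ji eq[OF I[unfolded Ii] J(1)[unfolded Ji]] by (rule lookup_ext_coords_word)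
qed

lemma omega_in_ext_power:
  assumes "J \<in> omega_index q" "2 \<le> q"
  shows "omega lam J \<in> ext_power q"
proof -
  obtain js i where J: "J = (js, i)" by (cases J) auto
  with assms have "length js + 2 = q" "sorted_wrt (<) (js @ [i])" by (auto simp: omega_index_def)
  then show ?thesis
    using omega_in_word_space word_space_subset_ext_power unfolding J by blast
qed

lemma omega_primitive:
  assumes "J \<in> omega_index q" "2 \<le> q"
  shows "ext_X (omega lam J) = 0"
    and "ext_deriv (verma_H lam) (omega lam J) =
      ext_scale (of_nat q * lam - 2 * of_nat (omega_degree J)) (omega lam J)"
proof -
  obtain js i where J: "J = (js, i)" by (cases J) auto
  with assms have *: "length js + 2 = q" "sorted_wrt (<) (js @ [i])" by (auto simp: omega_index_def)
  then show "ext_X (omega lam J) = 0" unfolding J by (intro ext_X_omega)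
  show "ext_deriv (verma_H lam) (omega lam J) =
      ext_scale (of_nat q * lam - 2 * of_nat (omega_degree J)) (omega lam J)"
    using ext_H_word_space[OF omega_in_word_space[OF *(2)]]
    unfolding J omega_degree_def prod.case *(1) .
qed

section \<open>The kernel of \<open>X\<close> on the exterior power\<close>

text \<open>A sorted word either is a gap word or is the leading word of some
  \<open>omega lam J\<close>, from which it differs by an element of the gap space.\<close>

lemma ext_power_decompose:
  assumes "x \<in> ext_power q" "2 \<le> q"
  obtains v g where "v \<in> ext.span (omega lam ` omega_index q)" "g \<in> gap_space q" "x = v + g"
proof -
  let ?S = "ext.span (omega lam ` omega_index q \<union> wedge_ft ` gap_lists q)"
  have "ext_power q \<subseteq> ?S"
    unfolding ext_power_eq_span_sorted
  proof (rule ext.span_minimal, safe)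
    fix ys :: "nat list" assume ys: "q = length ys" "sorted_wrt (<) ys"
    show "wedge_ft ys \<in> ext.span (omega lam ` omega_index (length ys) \<union> wedge_ft ` gap_lists (length ys))"
      using ys(2) refl assms(2)[unfolded ys(1)]
    proof (cases rule: strict_list_cases)
      case (consecutive js i)
      then have "sorted_wrt (<) (js @ [i])" by (simp add: omega_index_def)
      from omega_minus_leading[OF this]
      have "omega lam (js, i) - wedge_ft ys \<in> ext.span (wedge_ft ` gap_lists (length ys))"
        by (simp add: gap_space_def consecutive(2))
      then have "omega lam (js, i) - wedge_ft ys \<in>
          ext.span (omega lam ` omega_index (length ys) \<union> wedge_ft ` gap_lists (length ys))"
        using ext.span_mono[OF Un_upper2] by blast
      moreover have "omega lam (js, i) \<in>
          ext.span (omega lam ` omega_index (length ys) \<union> wedge_ft ` gap_lists (length ys))"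
        by (rule ext.span_base) (use consecutive in auto)
      ultimately show ?thesis using ext.span_diff[of "omega lam (js, i)" _ "omega lam (js, i) - wedge_ft ys"] by simp
    next
      case (gap xs m)
      then have "ys \<in> gap_lists (length ys)" by (auto simp: gap_lists_def)
      then show ?thesis by (intro ext.span_base) auto
    qed
  qed
  with assms(1) have "x \<in> ?S" by auto
  then show thesis
    unfolding ext.span_Un using that by (auto simp: gap_space_def)
qed

text \<open>
  In a combination \<open>g\<close> of wedge products from the gap space choose a term whose largest entry \<open>m\<close>
  is minimal.  Lowering \<open>m\<close> to \<open>m - 1\<close> produces a term of \<open>X g\<close> that nothing else can cancel.
\<close>

lemma ext_X_gap_space_eq_0:
  assumes "g \<in> gap_space q" "ext_X g = 0" "2 \<le> q"
  shows "g = 0"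
proof -
  obtain A r where A: "finite A" "A \<subseteq> gap_lists q" and g: "g = (\<Sum>ys\<in>A. ext_scale (r ys) (wedge_ft ys))"
    using assms(1) unfolding gap_space_def by (rule ext.span_image_obtain)
  define B where "B = {ys \<in> A. r ys \<noteq> 0}"
  have "B = {}"
  proof (rule ccontr)
    assume "B \<noteq> {}"
    then obtain ys where "is_arg_min last (\<lambda>ys. ys \<in> B) ys"
      using A(1) ex_is_arg_min_if_finite[of B last] by (auto simp: B_def)
    then have ys: "ys \<in> B" and min: "\<And>zs. zs \<in> B \<Longrightarrow> last ys \<le> last zs"
      by (auto simp: is_arg_min_linorder)
    then obtain xs m where xm: "ys = xs @ [m]" "sorted_wrt (<) xs" "\<And>x. x \<in> set xs \<Longrightarrow> Suc x < m" "Suc (length xs) = q"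
      using A by (auto simp: B_def gap_lists_def)
    have "xs \<noteq> []" using xm(4) assms(3) by auto
    then have m: "0 < m" using xm(3)[of "hd xs"] by simp
    \<comment> \<open>The gap leaves room to lower the last entry without a collision.\<close>
    have xm': "sorted_wrt (<) (xs @ [m - 1])" using xm(2,3) by (fastforce simp: sorted_wrt_snoc)
    define c where "c v = Poly_Mapping.lookup (ext_coords v) (set (xs @ [m - 1]))"
      for v :: "(nat, 'k) exterior_algebra"
    interpret c: Vector_Spaces.linear ext_scale "(*)" c
      unfolding c_def by (rule linear_ext_coord)
    have coord: "r zs * c (ext_X (wedge_ft zs)) = (if zs = ys then r ys * c (wedge_ft (xs @ [m - 1])) else 0)"
      if zs: "zs \<in> A" for zs
    proof (cases "r zs = 0")
      case True
      then show ?thesis using ys by (auto simp: B_def)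
    next
      case False
      then have "zs \<in> B" using zs by (simp add: B_def)
      obtain rs n where rn: "zs = rs @ [n]" "sorted_wrt (<) rs" "\<And>x. x \<in> set rs \<Longrightarrow> Suc x < n"
        using zs A(2) unfolding gap_lists_def by blast
      have mn: "m \<le> n" using min[OF \<open>zs \<in> B\<close>] by (simp add: xm(1) rn(1))
      then obtain n' where n: "n = Suc n'" using m by (cases n) auto
      \<comment> \<open>The Leibniz terms that lower a letter of \<open>rs\<close> keep the letter
        \<open>n\<close>, which is too large for the set read off by \<open>c\<close>.\<close>
      have "ext_X (wedge_ft rs) * ext_vec (ft n) \<in> ext.span (wedge_ft ` {w @ [n] | w. \<forall>x\<in>set w. x < n})"
      proof (rule ext.linear_image_span_subset[OF linear_ext_mult(2) ext_X_word[of rs n]])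
        fix b assume "b \<in> wedge_ft ` {w'. length w' = length rs \<and> Suc (sum_list w') = sum_list rs \<and> (\<forall>x\<in>set w'. x < n)}"
        then obtain w where w: "\<forall>x\<in>set w. x < n" "b = wedge_ft w" by blast
        then have "wedge_ft (w @ [n]) \<in> ext.span (wedge_ft ` {w @ [n] | w. \<forall>x\<in>set w. x < n})"
          by (intro ext.span_base imageI) auto
        then show "b * ext_vec (ft n) \<in> ext.span (wedge_ft ` {w @ [n] | w. \<forall>x\<in>set w. x < n})"
          by (simp add: w(2) wedge_simps)
      qed (use rn(3) in \<open>auto intro: Suc_lessD\<close>)
      then have "c (ext_X (wedge_ft rs) * ext_vec (ft n)) = 0"
        unfolding c_def
      proof (rule lookup_ext_coords_span)
        have "n \<notin> set (xs @ [m - 1])" using xm(3) mn m by fastforce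
        then show "set (xs @ [m - 1]) \<notin> set ` {w @ [n] | w. \<forall>x\<in>set w. x < n}" by auto
      qed
      moreover have "ext_X (wedge_ft zs) = ext_X (wedge_ft rs) * ext_vec (ft n) + wedge_ft (rs @ [n'])"
        by (simp add: rn(1) n wedge_simps ext_deriv_mult ext_deriv_vec linear_verma verma_X_ft_Suc ext_deriv_one)
      ultimately have eq: "c (ext_X (wedge_ft zs)) = c (wedge_ft (rs @ [n']))" by (simp add: c.add)
      show ?thesis
      proof (cases "zs = ys")
        case True
        then have "rs = xs" "n' = m - 1" by (auto simp: rn(1) n xm(1))
        with True eq show ?thesis by simp
      next
        case False
        have "sorted_wrt (<) (rs @ [n'])" using rn(2,3) n by (fastforce simp: sorted_wrt_snoc)
        \<comment> \<open>Raising the last entries again recovers \<open>ys\<close> and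
          \<open>zs\<close>, so distinct words stay distinct after lowering.\<close>
        moreover have "xs @ [m - 1] \<noteq> rs @ [n']" using False m by (auto simp: xm(1) rn(1) n)
        ultimately have "set (xs @ [m - 1]) \<noteq> set (rs @ [n'])"
          using strict_list_eqI[OF xm'] by blast
        then have "c (wedge_ft (rs @ [n'])) = 0" unfolding c_def by (rule lookup_ext_coords_word)
        with False eq show ?thesis by simp
      qed
    qed
    have "0 = c (ext_X g)" by (simp add: assms(2) c.zero)
    also have "\<dots> = (\<Sum>zs\<in>A. r zs * c (ext_X (wedge_ft zs)))"
      by (simp add: g ext_deriv_linear_simps c.sum c.scale)
    also have "\<dots> = (\<Sum>zs\<in>A. if zs = ys then r ys * c (wedge_ft (xs @ [m - 1])) else 0)"
      by (rule sum.cong[OF refl coord])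
    also have "\<dots> = r ys * c (wedge_ft (xs @ [m - 1]))"
      using A(1) ys by (simp add: B_def)
    finally have "c (wedge_ft (xs @ [m - 1])) = 0" using ys by (simp add: B_def)
    then show False
      using lookup_ext_coords_word_self[OF xm'] by (simp add: c_def)
  qed
  then show ?thesis by (simp add: g B_def)
qed

text \<open>The \<open>omega\<close> part of \<open>v\<close> is killed by \<open>X\<close>, hence
  so is its gap part, on which \<open>X\<close> is injective.\<close>

lemma ext_X_kernel:
  assumes "v \<in> ext_power q" "ext_X v = 0" "2 \<le> q"
  shows "v \<in> ext.span (omega lam ` omega_index q)"
proof -
  obtain u g where u: "u \<in> ext.span (omega lam ` omega_index q)" and g: "g \<in> gap_space q"
    and v: "v = u + g"
    using assms(1,3) by (rule ext_power_decompose)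
  have "ext_X u \<in> {0}"
    by (rule ext.linear_image_span_subset[OF linear_ext_deriv u])
      (use omega_primitive(1) assms(3) in auto)
  then have "ext_X g = 0" using assms(2) by (simp add: v ext_deriv_linear_simps)
  with ext_X_gap_space_eq_0[OF g _ assms(3)] u v show ?thesis by simp
qed

lemma ext_X_nilpotent:
  assumes "v \<in> ext_power q"
  shows "\<exists>n. (ext_X ^^ n) v = 0"
  using assms unfolding ext_power_eq_span_words
proof (induction rule: ext.span_induct_alt)
  case base
  then show ?case by (intro exI[of _ 0]) simp
next
  case (step c x y)
  then obtain w n where w: "x = wedge_ft w" and n: "(ext_X ^^ n) y = 0" by auto
  \<comment> \<open>For the empty word \<open>Max\<close> is unspecified, but the bound on the
    letters is then vacuous.\<close>
  have "wedge_ft w \<in> word_space (length w) (sum_list w) (Suc (Max (set w)))"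
    by (rule word_in_word_space) (auto simp: less_Suc_eq_le)
  then have x: "(ext_X ^^ Suc (sum_list w)) x = 0"
    unfolding w by (rule ext_X_pow_word_space_0) simp
  have "(ext_X ^^ (n + Suc (sum_list w))) x = 0"
    unfolding funpow_add o_apply x ext_verma.X_pow_0 ..
  moreover have "(ext_X ^^ (Suc (sum_list w) + n)) y = 0"
    unfolding funpow_add o_apply[of "ext_X ^^ Suc (sum_list w)"] n ext_verma.X_pow_0 ..
  ultimately show ?case
    by (intro exI[of _ "n + Suc (sum_list w)"])
      (simp only: ext_verma.X_pow_add ext_verma.X_pow_scale add.commute[of n] ext.scale_zero_right add_0)
qed

text \<open>The kernel of \<open>X\<close> has a basis of weight vectors, and in characteristic zero
  different degrees have different weights, so comparing \<open>H\<close>-eigenvalues selects the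
  degree \<open>k\<close>.\<close>

lemma primitive_vectors_eq_span:
  fixes k :: int
  assumes "2 \<le> q"
  shows "ext_verma.primitive_vectors lam (ext_power q) (of_nat q * lam - 2 * of_int k) =
    ext.span (omega lam ` {J \<in> omega_index q. int (omega_degree J) = k})"
    (is "?P = ext.span (omega lam ` ?B)")
proof
  show "?P \<subseteq> ext.span (omega lam ` ?B)"
  proof
    fix v assume "v \<in> ?P"
    then have v: "v \<in> ext_power q" "ext_X v = 0"
      "ext_deriv (verma_H lam) v = ext_scale (of_nat q * lam - 2 * of_int k) v"
      by (auto simp: ext_verma.primitive_vectors_def)
    obtain A r where A: "finite A" "A \<subseteq> omega_index q"
      and r: "v = (\<Sum>J\<in>A. ext_scale (r J) (omega lam J))"
      using ext_X_kernel[OF v(1,2) assms] by (rule ext.span_image_obtain)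
    have "0 = ext_deriv (verma_H lam) v - ext_scale (of_nat q * lam - 2 * of_int k) v"
      using v(3) by simp
    also have "\<dots> = (\<Sum>J\<in>A. ext_scale (r J * (2 * (of_int k - of_nat (omega_degree J)))) (omega lam J))"
      unfolding r ext_deriv_linear_simps ext.scale_sum_right sum_subtractf[symmetric]
    proof (rule sum.cong[OF refl])
      fix J assume "J \<in> A"
      then have J: "J \<in> omega_index q" using A by auto
      show "ext_scale (r J) (ext_deriv (verma_H lam) (omega lam J)) -
          ext_scale (of_nat q * lam - 2 * of_int k) (ext_scale (r J) (omega lam J)) =
          ext_scale (r J * (2 * (of_int k - of_nat (omega_degree J)))) (omega lam J)"
        unfolding omega_primitive(2)[OF J assms] ext.scale_scale ext.scale_left_diff_distrib[symmetric]
        by (rule arg_cong[of _ _ "\<lambda>c. ext_scale c _"]) (simp add: algebra_simps)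
    qed
    finally have zero: "r J * (2 * (of_int k - of_nat (omega_degree J))) = 0" if "J \<in> A" for J
      using ext.lin_indep_familyD[OF lin_indep_omega A] that by metis
    have "r J = 0" if "J \<in> A" "J \<notin> ?B" for J
    proof -
      have "(of_int k :: 'k) - of_nat (omega_degree J) = of_int (k - int (omega_degree J))" by simp
      moreover have "k - int (omega_degree J) \<noteq> 0" using that A by auto
      ultimately have "(of_int k :: 'k) - of_nat (omega_degree J) \<noteq> 0" by (metis of_int_eq_0_iff)
      with zero[OF that(1)] show ?thesis by simp
    qed
    then have "v = (\<Sum>J\<in>A \<inter> ?B. ext_scale (r J) (omega lam J))"
      unfolding r using A by (intro sum.mono_neutral_right) auto
    then show "v \<in> ext.span (omega lam ` ?B)"
      using ext.span_image_sum_mem[of "A \<inter> ?B" ?B] by simp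
  qed
  have "ext.subspace ?P"
    using ext_verma.submoduleD(1)[OF submodule_ext_power]
    by (auto simp: ext.subspace_def ext_verma.primitive_vectors_def ext_deriv_linear_simps
        ext.scale_right_distrib mult.commute)
  moreover have "omega lam J \<in> ?P" if "J \<in> ?B" for J
  proof -
    have "(of_int k :: 'k) = of_nat (omega_degree J)" using that by auto
    with that show ?thesis
      using omega_primitive[of J q] omega_in_ext_power[of J q] assms
      by (simp add: ext_verma.primitive_vectors_def)
  qed
  ultimately show "ext.span (omega lam ` ?B) \<subseteq> ?P"
    by (intro ext.span_minimal) auto
qed

section \<open>Reducibility and decomposition\<close>

lemma omega_nonzero:
  assumes "J \<in> omega_index q"
  shows "omega lam J \<noteq> 0"
  using ext.lin_indep_familyD[OF lin_indep_omega, of "{J}" q "\<lambda>_. 1" J] assms by auto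

text \<open>\<open>Y\<close> only raises the degree, so a primitive vector of nonminimal degree
  generates a submodule that misses the word \<open>0, ..., q - 1\<close> of minimal degree.\<close>

lemma ext_power_reducible:
  assumes "2 \<le> q"
  shows "ext_verma.reducible lam (ext_power q)"
proof -
  obtain p where q: "q = Suc (Suc p)" using assms by (metis Suc_le_D numeral_2_eq_2 Suc_le_mono)
  \<comment> \<open>The leading word \<open>0, ..., p - 1, p + 1, p + 2\<close> has degree two above
    the minimum; \<open>i = p\<close> would give the minimum itself.\<close>
  define w where "w = omega lam ([0..<p], Suc p)"
  let ?N = "ext_verma.generated lam w"
  have J: "([0..<p], Suc p) \<in> omega_index q"
    by (auto simp: omega_index_def q sorted_wrt_append)
  have "w \<in> ext_power q" unfolding w_def by (rule omega_in_ext_power[OF J assms])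
  then have "?N \<subseteq> ext_power q"
    by (rule ext_verma.generated_minimal[OF submodule_ext_power])
  moreover have "?N \<noteq> {0}"
    using ext_verma.generated_self[of w lam] omega_nonzero[OF J] by (auto simp: w_def)
  moreover have "wedge_ft [0..<q] \<notin> ?N"
  proof
    assume "wedge_ft [0..<q] \<in> ?N"
    also have "?N = ext.span (range (\<lambda>n. (ext_deriv verma_Y ^^ n) w))"
      unfolding w_def by (rule ext_verma.generated_primitive omega_primitive[OF J assms])+
    finally have "wedge_ft [0..<q] \<in> ext.span (range (\<lambda>n. (ext_deriv verma_Y ^^ n) w))" .
    moreover define W where "W = {v. length v = q \<and> sum_list [0..<q] < sum_list v}"
    have "(ext_deriv verma_Y ^^ n) w \<in> ext.span (wedge_ft ` W)" for n
    proof -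
      have "sorted_wrt (<) ([0..<p] @ [Suc p])" by (auto simp: sorted_wrt_append)
      from ext_Y_pow_word_space[OF omega_in_word_space[OF this], of n]
      show ?thesis
        unfolding w_def word_space_def
        by (rule rev_subsetD[OF _ ext.span_mono]) (auto simp: q W_def)
    qed
    then have "ext.span (range (\<lambda>n. (ext_deriv verma_Y ^^ n) w)) \<subseteq> ext.span (wedge_ft ` W)"
      by (intro ext.span_minimal) auto
    ultimately have "wedge_ft [0..<q] \<in> ext.span (wedge_ft ` W)" by blast
    \<comment> \<open>A word of length \<open>q\<close> with these letters is a permutation of
      \<open>[0..<q]\<close> and has the same sum.\<close>
    moreover have "set [0..<q] \<noteq> set v" if "v \<in> W" for v
    proof
      assume v: "set [0..<q] = set v"
      have "card (set v) = length v" unfolding v[symmetric] using that by (simp add: W_def)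
      then have "distinct v" by (rule card_distinct)
      then have "sum_list v = \<Sum>(set v)" by (simp add: distinct_sum_list_conv_Sum)
      also have "\<dots> = sum_list [0..<q]"
        unfolding v[symmetric] by (simp add: distinct_sum_list_conv_Sum)
      finally show False using that by (simp add: W_def)
    qed
    ultimately have "Poly_Mapping.lookup (ext_coords (wedge_ft [0..<q])) (set [0..<q]) = 0"
      by (intro lookup_ext_coords_span) auto
    then show False using lookup_ext_coords_word_self[of "[0..<q]"] by simp
  qed
  then have "?N \<noteq> ext_power q" using wedge_in_ext_power[of "map ft [0..<q]" q] by auto
  ultimately show ?thesis
    unfolding ext_verma.reducible_def
    using submodule_ext_power ext_verma.submodule_generated by blast
qed

text \<open>The degree is the sum of the strict list \<open>js @ [i, Suc i]\<close> of length
  \<open>q\<close>, hence at least \<open>0 + 1 + ... + (q - 1)\<close>.\<close>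

lemma omega_degree_ge:
  assumes "J \<in> omega_index q" "2 \<le> q"
  shows "q * (q - 1) \<le> 2 * omega_degree J"
proof -
  obtain js i where J: "J = (js, i)" by (cases J) auto
  have "sorted_wrt (<) (js @ [i, Suc i])" "length (js @ [i, Suc i]) = q"
    using assms by (auto simp: J omega_index_def sorted_wrt_append less_SucI)
  from strict_sum_ge[OF this(1)] have "(\<Sum>j<q. j) \<le> omega_degree J"
    unfolding \<open>length _ = q\<close> by (simp add: J omega_degree_def)
  moreover have "2 * (\<Sum>j<q. j) = q * (q - 1)"
    by (induction q) (simp_all add: algebra_simps)
  ultimately show ?thesis by linarith
qed

text \<open>Every weight lies below \<open>q lam - q (q - 1)\<close> by a natural number, so a
  natural weight would make that value natural too.\<close>

lemma direct_sum_generated_omega: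
  assumes "of_nat q * lam - of_nat (q * (q - 1)) \<notin> \<nat>" "2 \<le> q"
  shows "ext_verma.direct_sum_of_submodules lam (ext_power q) (omega_index q)
    (\<lambda>J. ext_verma.generated lam (omega lam J))"
proof (rule ext_verma.direct_sum_of_generated[OF submodule_ext_power])
  fix J and t :: nat assume J: "J \<in> omega_index q"
  have "of_nat q * lam - 2 * of_nat (omega_degree J) \<noteq> of_nat t"
  proof
    assume *: "of_nat q * lam - 2 * of_nat (omega_degree J) = of_nat t"
    have "of_nat q * lam - of_nat (q * (q - 1)) =
        (of_nat q * lam - of_nat (2 * omega_degree J)) + of_nat (2 * omega_degree J - q * (q - 1))"
      using omega_degree_ge[OF J assms(2)] by (simp only: of_nat_diff) simp
    also have "\<dots> = of_nat (t + (2 * omega_degree J - q * (q - 1)))"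
      using * by simp
    finally show False using assms(1) by (metis of_nat_in_Nats)
  qed
  then show "of_nat (Suc t) * ((of_nat q * lam - 2 * of_nat (omega_degree J)) - of_nat t) \<noteq> 0"
    by (simp only: mult_eq_0_iff of_nat_eq_0_iff right_minus_eq) simp
qed (use assms(2) in \<open>auto intro: omega_in_ext_power omega_primitive lin_indep_omega ext_X_kernel ext_X_nilpotent\<close>)

end

theorem theorem4p1:
  fixes lam :: "'k::field_char_0" and q :: nat
  assumes "verma.irreducible lam UNIV" and "2 \<le> q"
  shows
    "ext_verma.reducible lam (ext_power q) \<and>
     (\<forall>k::int.
        let P = ext_verma.primitive_vectors lam (ext_power q) (of_nat q * lam - 2 * of_int k);
            N = k - (int q - 3) * int q div 2;
            B = {J \<in> omega_index q. int (omega_degree J) = k}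
        in int (ext.dim P) = int (num_partitions q N) - int (num_partitions q (N - 1)) \<and>
           inj_on (omega lam) B \<and> ext.independent (omega lam ` B) \<and> ext.span (omega lam ` B) = P) \<and>
     (\<forall>J\<in>omega_index q.
        ext_verma.highest_weight_vector lam (omega lam J)
          (of_nat q * lam - 2 * of_nat (omega_degree J))) \<and>
     (of_nat q * lam - of_nat (q * (q - 1)) \<notin> \<nat> \<longrightarrow>
        ext_verma.direct_sum_of_submodules lam (ext_power q) (omega_index q)
          (\<lambda>J. ext_verma.generated lam (omega lam J)))"
proof -
  interpret irreducible_verma lam
    by unfold_locales (use assms(1) verma_irreducible_iff in blast)
  have "int (ext.dim (ext.span (omega lam ` B))) =
      int (num_partitions q (k - (int q - 3) * int q div 2)) -
      int (num_partitions q (k - (int q - 3) * int q div 2 - 1)) \<and>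
      inj_on (omega lam) B \<and> ext.independent (omega lam ` B)"
    if "B = {J \<in> omega_index q. int (omega_degree J) = k}" for k B
  proof -
    have indep: "lin_indep_family ext_scale (omega lam) B"
      by (rule ext.lin_indep_family_subset[OF lin_indep_omega[of q]]) (use that in blast)
    note inj = ext.lin_indep_family_inj[OF indep] and ind = ext.lin_indep_family_independent[OF indep]
    have "ext.dim (ext.span (omega lam ` B)) = card B"
      by (simp add: ext.dim_eq_card_independent[OF ind] card_image[OF inj])
    then show ?thesis
      \<comment> \<open>Lowering the degree from \<open>k\<close> to \<open>k - 1\<close> lowers the
        argument of \<open>num_partitions\<close> by one as well.\<close>
      using inj ind card_omega_index[OF assms(2), of k]
      unfolding that card_strict_lists diff_right_commute[of k 1] by simp
  qed
  then have "\<forall>k::int.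
      let P = ext_verma.primitive_vectors lam (ext_power q) (of_nat q * lam - 2 * of_int k);
          N = k - (int q - 3) * int q div 2;
          B = {J \<in> omega_index q. int (omega_degree J) = k}
      in int (ext.dim P) = int (num_partitions q N) - int (num_partitions q (N - 1)) \<and>
         inj_on (omega lam) B \<and> ext.independent (omega lam ` B) \<and> ext.span (omega lam ` B) = P"
    unfolding Let_def primitive_vectors_eq_span[OF assms(2)] by blast
  moreover have "ext_verma.highest_weight_vector lam (omega lam J)
      (of_nat q * lam - 2 * of_nat (omega_degree J))" if "J \<in> omega_index q" for J
    using omega_primitive[OF that assms(2)] omega_nonzero[OF that]
    by (simp add: ext_verma.highest_weight_vector_def)
  ultimately show ?thesis
    using ext_power_reducible[OF assms(2)] direct_sum_generated_omega[OF _ assms(2)] by blast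
qed

end
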